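(* In neutral constructive geometry (with intuitionistic logic), Euclid's Postulate 5 implies Playfair's axiom.
   Context: Logic is intuitionistic. Neutral constructive geometry means constructive plane geometry without any parallel postulate. Primitives: points, strict betweenness $B(a,b,c)$, segment congruence $ab=cd$; $T(a,b,c)$ abbreviates $\neg(a\neq b\wedge b\neq c\wedge\neg B(a,b,c))$. For $a\neq b$, a point $x$ lies on $\mathrm{Line}(a,b)$ iff $\neg\neg(B(a,b,x)\vee B(b,x,a)\vee B(x,a,b)\vee x=a\vee x=b)$; every line is given by two distinct points. Points are collinear if they lie on a common line. A circle is given by a center and a radius segment (possibly null). $ab\le cd$ means $\exists e\,(T(c,e,d)\wedge ab=ce)$. No particular axiomatization is prescribed; the principles used are: (1) Stability: $\neg\neg A\to A$ for $A$ an equality, betweenness or congruence. (2) $ab=ba$; $ab=pq\wedge ab=rs\to pq=rs$; $ab=cc\to a=b$. (3) Extension: if $a\neq b$ then for all $c,d$ there is $x$ with $T(a,b,x)$ and $bx=cd$. (4) Five-segment axiom: if $a\neq b$, $T(a,b,c)$, $T(a',b',c')$, $ab=a'b'$, $bc=b'c'$, $ad=a'd'$, $bd=b'd'$ then $cd=c'd'$. (5) $B(a,b,c)$ implies $B(c,b,a)$, $a\ne b$, $b\neq c$; $\neg B(a,b,a)$; $T(a,b,d)\wedge T(b,c,d)\to T(a,b,c)\wedge T(a,c,d)$; $T(a,b,c)\wedge T(b,c,d)\wedge b\neq c\to T(a,c,d)\wedge T(a,b,d)$; $B(a,b,c)\wedge B(a,b,d)\wedge\neg T(a,c,d)\to T(a,d,c)$.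 (6) Inner Pasch: if $a,b,c$ are not collinear, $B(a,p,c)$ and $B(b,q,c)$, there is $x$ with $B(p,x,b)$ and $B(q,x,a)$. (7) There are three non-collinear points; any three points each equidistant from two given distinct points are collinear. (8) Line-circle continuity: if $a\ne b$, $a$ is non-strictly inside a circle and $b$ non-strictly outside it, then the circle contains a point $x$ with $T(a,x,b)$. Circle-circle continuity: if two circles have distinct centers and the first has a point non-strictly inside and a point non-strictly outside the second, they have a common point. Two lines are parallel if they have no common point (plane geometry). Euclid 5: for all points $p,q,r,s,t,a$, if $B(q,a,r)$, $B(p,t,q)$, $B(s,t,r)$, $pt=qt$, $rt=st$, $p\neq r$, and $p$ is not on $\mathrm{Line}(s,q)$, then there is a point $x$ on both $\mathrm{Line}(s,q)$ and $\mathrm{Line}(p,a)$ with $B(p,a,x)$ and $B(s,q,x)$. Playfair's axiom: if lines $K$ and $M$ are both parallel to line $L$, and a point $p$ lies on both $K$ and $M$, then $K$ and $M$ have the same points. *)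

theory Defs
  imports Main
begin

section \<open>Intuitionistic first-order logic over the language of geometry\<close>

text \<open>
  The claim is about derivability in intuitionistic logic, so formulas and proofs are objects here.
  The language is one-sorted (points), with equality, strict betweenness and segment congruence.
  A term is a parameter (free variable) or a bound variable, the latter in de Bruijn notation.
\<close>

datatype tm = Par nat | Bnd nat

datatype fm =
    Falsum
  | Eq tm tm
  | Betw tm tm tm
  | Congr tm tm tm tm
  | Conj fm fm
  | Disj fm fm
  | Imp fm fm
  | Forall fm
  | Exists fm

fun params_tm :: "tm \<Rightarrow> nat set" where
  "params_tm (Par x) = {x}"
| "params_tm (Bnd i) = {}"

fun params :: "fm \<Rightarrow> nat set" where
  "params Falsum = {}"
| "params (Eq s t) = params_tm s \<union> params_tm t"
| "params (Betw s t u) = params_tm s \<union> params_tm t \<union> params_tm u"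
| "params (Congr s t u v) = params_tm s \<union> params_tm t \<union> params_tm u \<union> params_tm v"
| "params (Conj p q) = params p \<union> params q"
| "params (Disj p q) = params p \<union> params q"
| "params (Imp p q) = params p \<union> params q"
| "params (Forall p) = params p"
| "params (Exists p) = params p"

text \<open>
  \<open>inst i x p\<close> replaces the bound variable that has index \<open>i\<close> at the root of \<open>p\<close> by the parameter
  \<open>x\<close>. Only parameters are ever substituted, so nothing can be captured.
\<close>

fun inst_tm :: "nat \<Rightarrow> nat \<Rightarrow> tm \<Rightarrow> tm" where
  "inst_tm i x (Par y) = Par y"
| "inst_tm i x (Bnd j) = (if j = i then Par x else Bnd j)"

fun inst :: "nat \<Rightarrow> nat \<Rightarrow> fm \<Rightarrow> fm" where
  "inst i x Falsum = Falsum"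
| "inst i x (Eq s t) = Eq (inst_tm i x s) (inst_tm i x t)"
| "inst i x (Betw s t u) = Betw (inst_tm i x s) (inst_tm i x t) (inst_tm i x u)"
| "inst i x (Congr s t u v) =
     Congr (inst_tm i x s) (inst_tm i x t) (inst_tm i x u) (inst_tm i x v)"
| "inst i x (Conj p q) = Conj (inst i x p) (inst i x q)"
| "inst i x (Disj p q) = Disj (inst i x p) (inst i x q)"
| "inst i x (Imp p q) = Imp (inst i x p) (inst i x q)"
| "inst i x (Forall p) = Forall (inst (Suc i) x p)"
| "inst i x (Exists p) = Exists (inst (Suc i) x p)"

text \<open>Natural deduction for intuitionistic logic with equality (Gentzen's NJ).\<close>

inductive derives :: "fm set \<Rightarrow> fm \<Rightarrow> bool" (infix \<open>\<turnstile>\<close> 50) where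
  Assm: "p \<in> \<Gamma> \<Longrightarrow> \<Gamma> \<turnstile> p"
| FalsumE: "\<Gamma> \<turnstile> Falsum \<Longrightarrow> \<Gamma> \<turnstile> p"
| ConjI: "\<Gamma> \<turnstile> p \<Longrightarrow> \<Gamma> \<turnstile> q \<Longrightarrow> \<Gamma> \<turnstile> Conj p q"
| ConjE1: "\<Gamma> \<turnstile> Conj p q \<Longrightarrow> \<Gamma> \<turnstile> p"
| ConjE2: "\<Gamma> \<turnstile> Conj p q \<Longrightarrow> \<Gamma> \<turnstile> q"
| DisjI1: "\<Gamma> \<turnstile> p \<Longrightarrow> \<Gamma> \<turnstile> Disj p q"
| DisjI2: "\<Gamma> \<turnstile> q \<Longrightarrow> \<Gamma> \<turnstile> Disj p q"
| DisjE: "\<Gamma> \<turnstile> Disj p q \<Longrightarrow> insert p \<Gamma> \<turnstile> r \<Longrightarrow> insert q \<Gamma> \<turnstile> r \<Longrightarrow> \<Gamma> \<turnstile> r"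
| ImpI: "insert p \<Gamma> \<turnstile> q \<Longrightarrow> \<Gamma> \<turnstile> Imp p q"
| ImpE: "\<Gamma> \<turnstile> Imp p q \<Longrightarrow> \<Gamma> \<turnstile> p \<Longrightarrow> \<Gamma> \<turnstile> q"
| ForallI: "\<Gamma> \<turnstile> inst 0 x p \<Longrightarrow> x \<notin> params p \<Longrightarrow> \<forall>r\<in>\<Gamma>. x \<notin> params r \<Longrightarrow> \<Gamma> \<turnstile> Forall p"
| ForallE: "\<Gamma> \<turnstile> Forall p \<Longrightarrow> \<Gamma> \<turnstile> inst 0 x p"
| ExistsI: "\<Gamma> \<turnstile> inst 0 x p \<Longrightarrow> \<Gamma> \<turnstile> Exists p"
| ExistsE: "\<Gamma> \<turnstile> Exists p \<Longrightarrow> insert (inst 0 x p) \<Gamma> \<turnstile> q \<Longrightarrow>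
    x \<notin> params p \<Longrightarrow> x \<notin> params q \<Longrightarrow> \<forall>r\<in>\<Gamma>. x \<notin> params r \<Longrightarrow> \<Gamma> \<turnstile> q"
| EqRefl: "\<Gamma> \<turnstile> Eq (Par x) (Par x)"
| EqSubst: "\<Gamma> \<turnstile> Eq (Par x) (Par y) \<Longrightarrow> \<Gamma> \<turnstile> inst 0 x p \<Longrightarrow> \<Gamma> \<turnstile> inst 0 y p"


section \<open>Notation with named bound variables\<close>

text \<open>
  De Bruijn formulas are unreadable, so sentences are written with HOL binders and translated.
  A \<open>pterm\<close> or \<open>pform\<close> maps the number of enclosing quantifiers to the term or formula denoted
  there. A variable bound under \<open>n\<close> quantifiers and used under \<open>m\<close> (so \<open>m > n\<close>) is
  \<open>Bnd (m - Suc n)\<close>. For example \<open>sentence (\<^bold>\<forall>a. \<^bold>\<exists>b. a \<^bold>= b)\<close> is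
  \<open>Forall (Exists (Eq (Bnd 1) (Bnd 0)))\<close>.
\<close>

type_synonym pterm = "nat \<Rightarrow> tm"
type_synonym pform = "nat \<Rightarrow> fm"

definition pAll :: "(pterm \<Rightarrow> pform) \<Rightarrow> pform" (binder \<open>\<^bold>\<forall>\<close> 10) where
  "pAll f = (\<lambda>n. Forall (f (\<lambda>m. Bnd (m - Suc n)) (Suc n)))"

definition pEx :: "(pterm \<Rightarrow> pform) \<Rightarrow> pform" (binder \<open>\<^bold>\<exists>\<close> 10) where
  "pEx f = (\<lambda>n. Exists (f (\<lambda>m. Bnd (m - Suc n)) (Suc n)))"

definition pAnd :: "pform \<Rightarrow> pform \<Rightarrow> pform" (infixr \<open>\<^bold>\<and>\<close> 35) where
  "(p \<^bold>\<and> q) = (\<lambda>n. Conj (p n) (q n))"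

definition pOr :: "pform \<Rightarrow> pform \<Rightarrow> pform" (infixr \<open>\<^bold>\<or>\<close> 30) where
  "(p \<^bold>\<or> q) = (\<lambda>n. Disj (p n) (q n))"

definition pImp :: "pform \<Rightarrow> pform \<Rightarrow> pform" (infixr \<open>\<^bold>\<longrightarrow>\<close> 25) where
  "(p \<^bold>\<longrightarrow> q) = (\<lambda>n. Imp (p n) (q n))"

definition pNot :: "pform \<Rightarrow> pform" (\<open>\<^bold>\<not> _\<close> [40] 40) where
  "(\<^bold>\<not> p) = (\<lambda>n. Imp (p n) Falsum)"

definition pIff :: "pform \<Rightarrow> pform \<Rightarrow> pform" (infixr \<open>\<^bold>\<longleftrightarrow>\<close> 25) where
  "(p \<^bold>\<longleftrightarrow> q) = ((p \<^bold>\<longrightarrow> q) \<^bold>\<and> (q \<^bold>\<longrightarrow> p))"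

definition pEq :: "pterm \<Rightarrow> pterm \<Rightarrow> pform" (infix \<open>\<^bold>=\<close> 50) where
  "(a \<^bold>= b) = (\<lambda>n. Eq (a n) (b n))"

abbreviation pNeq :: "pterm \<Rightarrow> pterm \<Rightarrow> pform" (infix \<open>\<^bold>\<noteq>\<close> 50) where
  "a \<^bold>\<noteq> b \<equiv> \<^bold>\<not> (a \<^bold>= b)"

definition B :: "pterm \<Rightarrow> pterm \<Rightarrow> pterm \<Rightarrow> pform" where
  "B a b c = (\<lambda>n. Betw (a n) (b n) (c n))"

text \<open>\<open>congr a b c d\<close> is the congruence \<open>ab = cd\<close>.\<close>

definition congr :: "pterm \<Rightarrow> pterm \<Rightarrow> pterm \<Rightarrow> pterm \<Rightarrow> pform" where
  "congr a b c d = (\<lambda>n. Congr (a n) (b n) (c n) (d n))"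

definition sentence :: "pform \<Rightarrow> fm" where
  "sentence p = p 0"


section \<open>Neutral constructive geometry\<close>

definition T :: "pterm \<Rightarrow> pterm \<Rightarrow> pterm \<Rightarrow> pform" where
  "T a b c = (\<^bold>\<not> (a \<^bold>\<noteq> b \<^bold>\<and> b \<^bold>\<noteq> c \<^bold>\<and> \<^bold>\<not> B a b c))"

text \<open>
  Lines are given by two points; \<open>on_line x a b\<close> says that \<open>x\<close> lies on the line through \<open>a\<close> and \<open>b\<close>.
  That \<open>a\<close> and \<open>b\<close> are distinct is stated where a line is quantified.
\<close>

definition on_line :: "pterm \<Rightarrow> pterm \<Rightarrow> pterm \<Rightarrow> pform" where
  "on_line x a b = (\<^bold>\<not> \<^bold>\<not> (B a b x \<^bold>\<or> B b x a \<^bold>\<or> B x a b \<^bold>\<or> x \<^bold>= a \<^bold>\<or> x \<^bold>= b))"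

definition collinear :: "pterm \<Rightarrow> pterm \<Rightarrow> pterm \<Rightarrow> pform" where
  "collinear a b c =
     (\<^bold>\<exists>u v. u \<^bold>\<noteq> v \<^bold>\<and> on_line a u v \<^bold>\<and> on_line b u v \<^bold>\<and> on_line c u v)"

text \<open>\<open>seg_le a b c d\<close> is \<open>ab \<le> cd\<close>.\<close>

definition seg_le :: "pterm \<Rightarrow> pterm \<Rightarrow> pterm \<Rightarrow> pterm \<Rightarrow> pform" where
  "seg_le a b c d = (\<^bold>\<exists>e. T c e d \<^bold>\<and> congr a b c e)"

definition parallel :: "pterm \<Rightarrow> pterm \<Rightarrow> pterm \<Rightarrow> pterm \<Rightarrow> pform" where
  "parallel a b c d = (\<^bold>\<not> (\<^bold>\<exists>x. on_line x a b \<^bold>\<and> on_line x c d))"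

text \<open>
  A circle is a center \<open>c\<close> with a radius segment \<open>rs\<close>, possibly null: \<open>x\<close> lies on it if \<open>cx = rs\<close>,
  non-strictly inside if \<open>cx \<le> rs\<close>, non-strictly outside if \<open>rs \<le> cx\<close>.
\<close>

definition on_circle :: "pterm \<Rightarrow> pterm \<Rightarrow> pterm \<Rightarrow> pterm \<Rightarrow> pform" where
  "on_circle x c r s = congr c x r s"

definition inside :: "pterm \<Rightarrow> pterm \<Rightarrow> pterm \<Rightarrow> pterm \<Rightarrow> pform" where
  "inside x c r s = seg_le c x r s"

definition outside :: "pterm \<Rightarrow> pterm \<Rightarrow> pterm \<Rightarrow> pterm \<Rightarrow> pform" where
  "outside x c r s = seg_le r s c x"

definition stability_axioms :: "pform set" where
  "stability_axioms = {
     \<^bold>\<forall>a b. \<^bold>\<not> \<^bold>\<not> (a \<^bold>= b) \<^bold>\<longrightarrow> a \<^bold>= b,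
     \<^bold>\<forall>a b c. \<^bold>\<not> \<^bold>\<not> B a b c \<^bold>\<longrightarrow> B a b c,
     \<^bold>\<forall>a b c d. \<^bold>\<not> \<^bold>\<not> congr a b c d \<^bold>\<longrightarrow> congr a b c d}"

definition congruence_axioms :: "pform set" where
  "congruence_axioms = {
     \<^bold>\<forall>a b. congr a b b a,
     \<^bold>\<forall>a b p q r s. congr a b p q \<^bold>\<and> congr a b r s \<^bold>\<longrightarrow> congr p q r s,
     \<^bold>\<forall>a b c. congr a b c c \<^bold>\<longrightarrow> a \<^bold>= b}"

definition extension_axiom :: pform where
  "extension_axiom =
     (\<^bold>\<forall>a b. a \<^bold>\<noteq> b \<^bold>\<longrightarrow> (\<^bold>\<forall>c d. \<^bold>\<exists>x. T a b x \<^bold>\<and> congr b x c d))"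

definition five_segment_axiom :: pform where
  "five_segment_axiom =
     (\<^bold>\<forall>a b c d a' b' c' d'.
        a \<^bold>\<noteq> b \<^bold>\<and> T a b c \<^bold>\<and> T a' b' c' \<^bold>\<and> congr a b a' b' \<^bold>\<and> congr b c b' c' \<^bold>\<and>
        congr a d a' d' \<^bold>\<and> congr b d b' d' \<^bold>\<longrightarrow> congr c d c' d')"

definition betweenness_axioms :: "pform set" where
  "betweenness_axioms = {
     \<^bold>\<forall>a b c. B a b c \<^bold>\<longrightarrow> B c b a \<^bold>\<and> a \<^bold>\<noteq> b \<^bold>\<and> b \<^bold>\<noteq> c,
     \<^bold>\<forall>a b. \<^bold>\<not> B a b a,
     \<^bold>\<forall>a b c d. T a b d \<^bold>\<and> T b c d \<^bold>\<longrightarrow> T a b c \<^bold>\<and> T a c d,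
     \<^bold>\<forall>a b c d. T a b c \<^bold>\<and> T b c d \<^bold>\<and> b \<^bold>\<noteq> c \<^bold>\<longrightarrow> T a c d \<^bold>\<and> T a b d,
     \<^bold>\<forall>a b c d. B a b c \<^bold>\<and> B a b d \<^bold>\<and> \<^bold>\<not> T a c d \<^bold>\<longrightarrow> T a d c}"

definition inner_pasch_axiom :: pform where
  "inner_pasch_axiom =
     (\<^bold>\<forall>a b c p q. \<^bold>\<not> collinear a b c \<^bold>\<and> B a p c \<^bold>\<and> B b q c \<^bold>\<longrightarrow>
        (\<^bold>\<exists>x. B p x b \<^bold>\<and> B q x a))"

definition dimension_axioms :: "pform set" where
  "dimension_axioms = {
     \<^bold>\<exists>a b c. \<^bold>\<not> collinear a b c,
     \<^bold>\<forall>p q a b c. p \<^bold>\<noteq> q \<^bold>\<and> congr a p a q \<^bold>\<and> congr b p b q \<^bold>\<and> congr c p c q \<^bold>\<longrightarrow>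
       collinear a b c}"

definition line_circle_axiom :: pform where
  "line_circle_axiom =
     (\<^bold>\<forall>a b c r s. a \<^bold>\<noteq> b \<^bold>\<and> inside a c r s \<^bold>\<and> outside b c r s \<^bold>\<longrightarrow>
        (\<^bold>\<exists>x. on_circle x c r s \<^bold>\<and> T a x b))"

definition circle_circle_axiom :: pform where
  "circle_circle_axiom =
     (\<^bold>\<forall>c r s c' r' s' p q.
        c \<^bold>\<noteq> c' \<^bold>\<and> on_circle p c r s \<^bold>\<and> inside p c' r' s' \<^bold>\<and>
        on_circle q c r s \<^bold>\<and> outside q c' r' s' \<^bold>\<longrightarrow>
        (\<^bold>\<exists>x. on_circle x c r s \<^bold>\<and> on_circle x c' r' s'))"

definition neutral_geometry :: "fm set" where
  "neutral_geometry = sentence `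
     (stability_axioms \<union> congruence_axioms \<union> betweenness_axioms \<union> dimension_axioms \<union>
      {extension_axiom, five_segment_axiom, inner_pasch_axiom,
       line_circle_axiom, circle_circle_axiom})"


section \<open>The two parallel postulates\<close>

definition euclid5 :: pform where
  "euclid5 =
     (\<^bold>\<forall>p q r s t a.
        B q a r \<^bold>\<and> B p t q \<^bold>\<and> B s t r \<^bold>\<and> congr p t q t \<^bold>\<and> congr r t s t \<^bold>\<and>
        p \<^bold>\<noteq> r \<^bold>\<and> \<^bold>\<not> on_line p s q \<^bold>\<longrightarrow>
        (\<^bold>\<exists>x. on_line x s q \<^bold>\<and> on_line x p a \<^bold>\<and> B p a x \<^bold>\<and> B s q x))"

text \<open>The lines \<open>K\<close>, \<open>M\<close>, \<open>L\<close> are given by the pairs \<open>k k'\<close>, \<open>m m'\<close>, \<open>l l'\<close>.\<close>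

definition playfair :: pform where
  "playfair =
     (\<^bold>\<forall>k k' m m' l l' p.
        k \<^bold>\<noteq> k' \<^bold>\<and> m \<^bold>\<noteq> m' \<^bold>\<and> l \<^bold>\<noteq> l' \<^bold>\<and>
        parallel k k' l l' \<^bold>\<and> parallel m m' l l' \<^bold>\<and>
        on_line p k k' \<^bold>\<and> on_line p m m' \<^bold>\<longrightarrow>
        (\<^bold>\<forall>x. on_line x k k' \<^bold>\<longleftrightarrow> on_line x m m'))"

end

theory Submission
  imports Defs "HOL-Library.Countable"
begin

text \<open>
  Playfair's axiom is a negative statement: parallelism is a negation and lying on a line is a
  doubly negated disjunction. For negative conclusions intuitionistic and classical derivability
  agree, provided that the axioms imply their Goedel-Gentzen negative translations, and they do. An
  existential quantifier in the conclusion of an axiom is only weakened by the translation. A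
  hypothesis with an existential quantifier still follows from its translation up to a double
  negation, which is harmless because the translated conclusion is stable. So it is enough to show
  that every classical structure that satisfies the axioms and Euclid 5 satisfies Playfair's axiom.
  This reduction is \<open>classical_semantics_suffices\<close>; it rests on a Henkin construction for the
  negative translation (\<open>truth_set_exists\<close>) and on a syntactic description of the formulas that pass
  through the translation (\<open>transfers_sound\<close>).

  The rest is classical plane geometry. Let \<open>p\<close> be a point outside the line \<open>L\<close>, let \<open>q\<close> and \<open>s\<close> be
  on \<open>L\<close>, let \<open>t\<close> be the midpoint of \<open>pq\<close> and let \<open>r\<close> be the reflection of \<open>s\<close> in \<open>t\<close>. Every line \<open>N\<close>
  through \<open>p\<close> that does not meet \<open>L\<close> contains \<open>r\<close>; hence two such lines share \<open>p\<close> and \<open>r\<close> and are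
  equal. For suppose that \<open>N\<close> misses \<open>r\<close>, and let \<open>r'\<close> be the reflection of \<open>r\<close> in \<open>p\<close>. As \<open>N\<close>
  passes through the midpoint \<open>p\<close> of \<open>rr'\<close>, by Pasch's axiom for the plane it meets \<open>qr\<close> or \<open>qr'\<close>
  (\<open>plane_pasch\<close>), say in \<open>x\<close>. Then Euclid 5, applied to the parallelogram with diagonals \<open>pq\<close> and
  \<open>rs\<close> (or to its neighbour, with the reflection of \<open>s\<close> in \<open>q\<close> in place of \<open>s\<close>), says that
  the line \<open>px\<close>, which is \<open>N\<close>, meets \<open>L\<close>.

  The work in the geometry lies in \<open>plane_pasch\<close>. Inner Pasch holds in all dimensions, so the
  two-dimensional form has to use that points equidistant from two given points are collinear. That
  enters through perpendiculars: two points whose feet on \<open>N\<close> coincide are collinear with the foot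
  (\<open>perp_Col\<close>), and the reflection in a suitable point of \<open>N\<close> moves any foot to any other.
\<close>

section \<open>Derivations\<close>

abbreviation Neg :: "fm \<Rightarrow> fm" where "Neg p \<equiv> Imp p Falsum"

fun ren_tm :: "(nat \<Rightarrow> nat) \<Rightarrow> tm \<Rightarrow> tm" where
  "ren_tm f (Par x) = Par (f x)"
| "ren_tm f (Bnd i) = Bnd i"

fun ren :: "(nat \<Rightarrow> nat) \<Rightarrow> fm \<Rightarrow> fm" where
  "ren f Falsum = Falsum"
| "ren f (Eq s t) = Eq (ren_tm f s) (ren_tm f t)"
| "ren f (Betw s t u) = Betw (ren_tm f s) (ren_tm f t) (ren_tm f u)"
| "ren f (Congr s t u v) = Congr (ren_tm f s) (ren_tm f t) (ren_tm f u) (ren_tm f v)"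
| "ren f (Conj p q) = Conj (ren f p) (ren f q)"
| "ren f (Disj p q) = Disj (ren f p) (ren f q)"
| "ren f (Imp p q) = Imp (ren f p) (ren f q)"
| "ren f (Forall p) = Forall (ren f p)"
| "ren f (Exists p) = Exists (ren f p)"

lemma ren_tm_id: "ren_tm (\<lambda>x. x) t = t" by (cases t) auto
lemma ren_id: "ren (\<lambda>x. x) p = p" by (induction p) (simp_all add: ren_tm_id)

lemma ren_tm_cong: "(\<And>x. x \<in> params_tm t \<Longrightarrow> f x = g x) \<Longrightarrow> ren_tm f t = ren_tm g t"
  by (cases t) auto
lemma ren_cong: "(\<And>x. x \<in> params p \<Longrightarrow> f x = g x) \<Longrightarrow> ren f p = ren g p"
  by (induction p) (auto intro: ren_tm_cong)

lemma ren_inst_tm: "ren_tm f (inst_tm i x t) = inst_tm i (f x) (ren_tm f t)" by (cases t) auto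
lemma ren_inst: "ren f (inst i x p) = inst i (f x) (ren f p)"
  by (induction p arbitrary: i) (auto simp: ren_inst_tm)

lemma params_tm_finite: "finite (params_tm t)" by (cases t) auto
lemma params_finite: "finite (params p)" by (induction p) (auto simp: params_tm_finite)

lemma fresh_param: "finite A \<Longrightarrow> \<exists>x. \<forall>p\<in>A. x \<notin> params p"
proof -
  assume "finite A"
  then have "finite (\<Union>(params ` A))" by (auto simp: params_finite)
  then obtain x where "x \<notin> \<Union>(params ` A)" using ex_new_if_finite[OF infinite_UNIV_nat] by blast
  then show ?thesis by blast
qed

text \<open>
  Eigenvariables block the direct proof of weakening, because a larger context may mention them.
  Renaming the parameters along with the induction leaves room to choose them afresh.
\<close>

lemma ren_derives:
  "\<Gamma> \<turnstile> p \<Longrightarrow> finite \<Delta> \<Longrightarrow> ren f ` \<Gamma> \<subseteq> \<Delta> \<Longrightarrow> \<Delta> \<turnstile> ren f p"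
proof (induction arbitrary: \<Delta> f rule: derives.induct)
  case (ForallI \<Gamma> x p)
  obtain y where y: "\<forall>r\<in>insert (ren f p) \<Delta>. y \<notin> params r"
    using fresh_param[of "insert (ren f p) \<Delta>"] ForallI.prems by auto
  \<comment> \<open>The eigenvariable is sent to a parameter that is fresh for the new context.\<close>
  let ?g = "f(x := y)"
  have g: "ren ?g p = ren f p" "\<And>r. r \<in> \<Gamma> \<Longrightarrow> ren ?g r = ren f r"
    by (rule ren_cong, use ForallI.hyps in auto)+
  have "\<Delta> \<turnstile> ren ?g (inst 0 x p)"
    by (rule ForallI.IH) (use ForallI.prems g in \<open>auto simp del: fun_upd_apply\<close>)
  then show ?case using y by (auto simp: ren_inst g intro!: derives.ForallI[of _ y])
next
  case (ExistsE \<Gamma> p x q)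
  obtain y where y: "\<forall>r\<in>{ren f p, ren f q} \<union> \<Delta>. y \<notin> params r"
    using fresh_param[of "{ren f p, ren f q} \<union> \<Delta>"] ExistsE.prems by auto
  let ?g = "f(x := y)"
  have g: "ren ?g p = ren f p" "ren ?g q = ren f q" "\<And>r. r \<in> \<Gamma> \<Longrightarrow> ren ?g r = ren f r"
    by (rule ren_cong, use ExistsE.hyps in auto)+
  have "\<Delta> \<turnstile> ren f (Exists p)" by (rule ExistsE.IH(1)) (use ExistsE.prems in auto)
  moreover have "insert (inst 0 y (ren f p)) \<Delta> \<turnstile> ren ?g q"
    by (rule ExistsE.IH(2)) (use ExistsE.prems g in \<open>auto simp: ren_inst simp del: fun_upd_apply, simp\<close>)
  ultimately show ?case using y g by (auto intro!: derives.ExistsE[of \<Delta> "ren f p" y])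
next
  case (DisjE \<Gamma> p q r)
  have "\<Delta> \<turnstile> ren f (Disj p q)" by (rule DisjE.IH(1)) (use DisjE.prems in auto)
  moreover have "insert (ren f p) \<Delta> \<turnstile> ren f r" by (rule DisjE.IH(2)) (use DisjE.prems in auto)
  moreover have "insert (ren f q) \<Delta> \<turnstile> ren f r" by (rule DisjE.IH(3)) (use DisjE.prems in auto)
  ultimately show ?case by (auto intro: derives.DisjE)
next
  case (EqSubst \<Gamma> x y p)
  have "\<Delta> \<turnstile> Eq (Par (f x)) (Par (f y))" "\<Delta> \<turnstile> inst 0 (f x) (ren f p)"
    using EqSubst.IH[of \<Delta> f] EqSubst.prems by (auto simp: ren_inst)
  then show ?case by (auto simp: ren_inst intro: derives.EqSubst)
next
  case (ForallE \<Gamma> p x)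
  then have "\<Delta> \<turnstile> Forall (ren f p)" by auto
  then show ?case by (auto simp: ren_inst intro: derives.ForallE)
next
  case (ExistsI \<Gamma> x p)
  then have "\<Delta> \<turnstile> inst 0 (f x) (ren f p)" by (auto simp: ren_inst)
  then show ?case by (auto intro: derives.ExistsI)
next
  case (ImpI p \<Gamma> q)
  have "insert (ren f p) \<Delta> \<turnstile> ren f q" by (rule ImpI.IH) (use ImpI.prems in auto)
  then show ?case by (auto intro: derives.ImpI)
next
  case (ImpE \<Gamma> p q)
  then show ?case using derives.ImpE[of \<Delta> "ren f p" "ren f q"] by auto
next
  case (ConjE1 \<Gamma> p q)
  then show ?case using derives.ConjE1[of \<Delta> "ren f p" "ren f q"] by auto
next
  case (ConjE2 \<Gamma> p q)
  then show ?case using derives.ConjE2[of \<Delta> "ren f p" "ren f q"] by auto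
qed (auto intro: derives.intros)

lemma weakening: "\<Gamma> \<turnstile> p \<Longrightarrow> \<Gamma> \<subseteq> \<Delta> \<Longrightarrow> finite \<Delta> \<Longrightarrow> \<Delta> \<turnstile> p"
  using ren_derives[of \<Gamma> p \<Delta> "\<lambda>x. x"] by (auto simp: ren_id image_def)

lemma cut: "\<Gamma> \<turnstile> p \<Longrightarrow> insert p \<Gamma> \<turnstile> q \<Longrightarrow> \<Gamma> \<turnstile> q"
  by (blast intro: ImpI ImpE)

lemma cut_set:
  assumes "finite G" "finite \<Gamma>" "\<And>p. p \<in> G \<Longrightarrow> \<Gamma> \<turnstile> p" "G \<union> \<Gamma> \<turnstile> q"
  shows "\<Gamma> \<turnstile> q"
  using assms
proof (induction G)
  case (insert p G)
  have "G \<union> \<Gamma> \<turnstile> p" using weakening[of \<Gamma> p "G \<union> \<Gamma>"] insert by auto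
  then have "G \<union> \<Gamma> \<turnstile> q" using insert.prems(3) by (auto intro: cut)
  then show ?case using insert by auto
qed auto

text \<open>
  An implication is read as in a Kripke model whose worlds are the finite contexts. With this and the
  similar facts below, derivability of a compound formula is treated by ordinary logical reasoning.
\<close>

lemma Imp_iff:
  assumes "finite \<Gamma>"
  shows "\<Gamma> \<turnstile> Imp p q \<longleftrightarrow> (\<forall>\<Delta>. finite \<Delta> \<and> \<Gamma> \<subseteq> \<Delta> \<and> \<Delta> \<turnstile> p \<longrightarrow> \<Delta> \<turnstile> q)"
proof
  assume "\<Gamma> \<turnstile> Imp p q"
  then show "\<forall>\<Delta>. finite \<Delta> \<and> \<Gamma> \<subseteq> \<Delta> \<and> \<Delta> \<turnstile> p \<longrightarrow> \<Delta> \<turnstile> q"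
    using weakening ImpE by meson
next
  assume "\<forall>\<Delta>. finite \<Delta> \<and> \<Gamma> \<subseteq> \<Delta> \<and> \<Delta> \<turnstile> p \<longrightarrow> \<Delta> \<turnstile> q"
  then have "insert p \<Gamma> \<turnstile> q" using assms Assm[of p "insert p \<Gamma>"] by blast
  then show "\<Gamma> \<turnstile> Imp p q" by (rule ImpI)
qed

lemma Neg_iff:
  assumes "finite \<Gamma>"
  shows "\<Gamma> \<turnstile> Neg p \<longleftrightarrow> (\<forall>\<Delta>. finite \<Delta> \<and> \<Gamma> \<subseteq> \<Delta> \<and> \<Delta> \<turnstile> p \<longrightarrow> \<Delta> \<turnstile> Falsum)"
  by (rule Imp_iff[OF assms])

lemma Conj_iff: "\<Gamma> \<turnstile> Conj p q \<longleftrightarrow> \<Gamma> \<turnstile> p \<and> \<Gamma> \<turnstile> q"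
  by (blast intro: ConjI ConjE1 ConjE2)

lemma Forall_iff:
  assumes "finite \<Gamma>"
  shows "\<Gamma> \<turnstile> Forall p \<longleftrightarrow> (\<forall>x. \<Gamma> \<turnstile> inst 0 x p)"
proof
  assume "\<forall>x. \<Gamma> \<turnstile> inst 0 x p"
  moreover obtain x where "\<forall>r\<in>insert p \<Gamma>. x \<notin> params r"
    using fresh_param[of "insert p \<Gamma>"] assms by auto
  ultimately show "\<Gamma> \<turnstile> Forall p" by (auto intro: ForallI[of _ x])
qed (blast intro: ForallE)

lemma Disj_Neg:
  assumes "finite \<Gamma>" "\<Gamma> \<turnstile> Disj p q" "\<Gamma> \<turnstile> Neg p" "\<Gamma> \<turnstile> Neg q" shows "\<Gamma> \<turnstile> Falsum"
proof (rule DisjE[OF assms(2)])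
  show "insert p \<Gamma> \<turnstile> Falsum"
    using assms(1,3) Assm[of p "insert p \<Gamma>"] Neg_iff[of \<Gamma> p] by auto
  show "insert q \<Gamma> \<turnstile> Falsum"
    using assms(1,4) Assm[of q "insert q \<Gamma>"] Neg_iff[of \<Gamma> q] by auto
qed

lemma Exists_Neg:
  assumes "finite \<Gamma>" "\<Gamma> \<turnstile> Exists p" "\<And>x. \<Gamma> \<turnstile> Neg (inst 0 x p)" shows "\<Gamma> \<turnstile> Falsum"
proof -
  obtain x where x: "\<forall>r\<in>insert p \<Gamma>. x \<notin> params r"
    using fresh_param[of "insert p \<Gamma>"] assms(1) by auto
  have "insert (inst 0 x p) \<Gamma> \<turnstile> Falsum"
    using assms(1,3) Assm[of "inst 0 x p" "insert (inst 0 x p) \<Gamma>"] Neg_iff[of \<Gamma> "inst 0 x p"] by auto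
  then show ?thesis using x by (auto intro: ExistsE[OF assms(2), of x])
qed

section \<open>The negative translation\<close>

text \<open>
  The Goedel-Gentzen translation. Atoms are doubly negated too, so that translated formulas are stable
  in pure logic, even those with dangling bound variables, to which no stability axiom applies.
\<close>

fun negtr :: "fm \<Rightarrow> fm" where
  "negtr Falsum = Falsum"
| "negtr (Eq s t) = Neg (Neg (Eq s t))"
| "negtr (Betw s t u) = Neg (Neg (Betw s t u))"
| "negtr (Congr s t u v) = Neg (Neg (Congr s t u v))"
| "negtr (Conj p q) = Conj (negtr p) (negtr q)"
| "negtr (Disj p q) = Neg (Conj (Neg (negtr p)) (Neg (negtr q)))"
| "negtr (Imp p q) = Imp (negtr p) (negtr q)"
| "negtr (Forall p) = Forall (negtr p)"
| "negtr (Exists p) = Neg (Forall (Neg (negtr p)))"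

lemma negtr_inst: "negtr (inst i x p) = inst i x (negtr p)"
  by (induction p arbitrary: i) auto

lemma size_inst [simp]: "size (inst i x p) = size p"
proof -
  have t: "size (inst_tm i x t) = size t" for i t by (cases t) auto
  show ?thesis by (induction p arbitrary: i) (auto simp: t)
qed

lemma params_negtr: "params (negtr p) = params p"
  by (induction p) auto

lemma Neg_Neg_Neg: "finite \<Gamma> \<Longrightarrow> \<Gamma> \<turnstile> Neg (Neg (Neg p)) \<Longrightarrow> \<Gamma> \<turnstile> Neg p"
  by (smt (verit) Neg_iff ImpE dual_order.trans order_refl weakening)

text \<open>
  Only the shape of translated formulas matters: they are built from \<open>Falsum\<close> and negations by
  conjunction, implication and universal quantification, all of which preserve stability. The induction is on the
  size, because instances of a formula are not among its subformulas.
\<close>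

lemma negtr_stable: "finite \<Gamma> \<Longrightarrow> \<Gamma> \<turnstile> Neg (Neg (negtr p)) \<Longrightarrow> \<Gamma> \<turnstile> negtr p"
proof (induction p arbitrary: \<Gamma> rule: measure_induct_rule[where f = size])
  case (less p)
  note nn = \<open>\<Gamma> \<turnstile> Neg (Neg (negtr p))\<close> and fin = \<open>finite \<Gamma>\<close>
  have map: "\<Gamma> \<turnstile> Neg (Neg r)" if "\<And>\<Delta>. finite \<Delta> \<Longrightarrow> \<Gamma> \<subseteq> \<Delta> \<Longrightarrow> \<Delta> \<turnstile> negtr p \<Longrightarrow> \<Delta> \<turnstile> r" for r
    unfolding Neg_iff[OF fin]
  proof safe
    fix \<Delta> assume d: "finite \<Delta>" "\<Gamma> \<subseteq> \<Delta>" "\<Delta> \<turnstile> Neg r"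
    then have "\<Delta> \<turnstile> Neg (negtr p)"
      using that by (metis ImpE Neg_iff order_trans weakening)
    then show "\<Delta> \<turnstile> Falsum" using d nn fin by (metis ImpE weakening)
  qed
  show ?case
  proof (cases p)
    case (Conj a b)
    have "\<Gamma> \<turnstile> Neg (Neg (negtr a))" "\<Gamma> \<turnstile> Neg (Neg (negtr b))"
      by (rule map, simp add: Conj Conj_iff)+
    then show ?thesis using less.IH[of a] less.IH[of b] fin by (auto simp: Conj Conj_iff)
  next
    case (Imp a b)
    have "\<Delta> \<turnstile> negtr b" if d: "finite \<Delta>" "\<Gamma> \<subseteq> \<Delta>" "\<Delta> \<turnstile> negtr a" for \<Delta>
    proof -
      have "\<Delta> \<turnstile> Neg (Neg (negtr b))" unfolding Neg_iff[OF d(1)]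
      proof safe
        fix \<Theta> assume t: "finite \<Theta>" "\<Delta> \<subseteq> \<Theta>" "\<Theta> \<turnstile> Neg (negtr b)"
        have "\<Theta> \<turnstile> Neg (negtr p)" unfolding Neg_iff[OF t(1)] Imp negtr.simps
          by (metis ImpE d(3) order_trans t(2,3) weakening)
        then show "\<Theta> \<turnstile> Falsum" by (metis ImpE nn order_trans d(2) t(1,2) weakening)
      qed
      then show ?thesis using less.IH[of b \<Delta>] Imp d by auto
    qed
    then show ?thesis using fin by (auto simp: Imp Imp_iff)
  next
    case (Forall a)
    have "\<Gamma> \<turnstile> negtr (inst 0 x a)" for x
    proof (rule less.IH)
      show "\<Gamma> \<turnstile> Neg (Neg (negtr (inst 0 x a)))"
        by (rule map) (auto simp: Forall negtr_inst intro: ForallE)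
    qed (auto simp: Forall fin)
    then show ?thesis using fin by (auto simp: Forall Forall_iff negtr_inst)
  next
    case Falsum
    then show ?thesis using nn fin by (auto simp: Neg_iff)
  qed (use nn fin in \<open>auto intro: Neg_Neg_Neg\<close>)
qed


section \<open>Formulas that pass through the translation\<close>

text \<open>
  Three ways in which a formula \<open>p\<close> can be compared with its translation: \<open>p\<close> implies it, it implies
  \<open>p\<close> up to a double negation, or it implies \<open>p\<close>. They are defined together because an implication
  exchanges the directions of its premise. Universal quantifiers are excluded from \<open>Out_weak\<close> because
  the double negation shift is not intuitionistically valid, and atoms from \<open>Out\<close> because their
  stability is not a matter of logic.
\<close>

datatype direction = Into | Out_weak | Out

fun transfers :: "direction \<Rightarrow> fm \<Rightarrow> bool" where
  "transfers v Falsum = True"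
| "transfers v (Eq s t) = (v \<noteq> Out)"
| "transfers v (Betw s t u) = (v \<noteq> Out)"
| "transfers v (Congr s t u w) = (v \<noteq> Out)"
| "transfers v (Conj p q) = (transfers v p \<and> transfers v q)"
| "transfers v (Disj p q) = (v \<noteq> Out \<and> transfers v p \<and> transfers v q)"
| "transfers v (Imp p q) = (case v of Into \<Rightarrow> transfers Out_weak p \<and> transfers Into q
     | Out_weak \<Rightarrow> transfers Into p \<and> transfers Out_weak q | Out \<Rightarrow> transfers Into p \<and> transfers Out q)"
| "transfers v (Forall p) = (v \<noteq> Out_weak \<and> transfers v p)"
| "transfers v (Exists p) = (v \<noteq> Out \<and> transfers v p)"

lemma transfers_inst [simp]: "transfers v (inst i x p) = transfers v p"
  by (induction p arbitrary: i v) (auto split: direction.split)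

lemma double_neg: "finite \<Gamma> \<Longrightarrow> \<Gamma> \<turnstile> p \<Longrightarrow> \<Gamma> \<turnstile> Neg (Neg p)"
  by (metis ImpE Neg_iff weakening)

lemma Neg_NegI:
  assumes "finite \<Gamma>" "\<And>\<Delta>. finite \<Delta> \<Longrightarrow> \<Gamma> \<subseteq> \<Delta> \<Longrightarrow> \<Delta> \<turnstile> Neg p \<Longrightarrow> \<Delta> \<turnstile> Falsum"
  shows "\<Gamma> \<turnstile> Neg (Neg p)"
  using assms Neg_iff by auto

lemma Neg_NegE:
  assumes "finite \<Gamma>" "\<Gamma> \<turnstile> Neg (Neg p)" "\<And>\<Delta>. finite \<Delta> \<Longrightarrow> \<Gamma> \<subseteq> \<Delta> \<Longrightarrow> \<Delta> \<turnstile> p \<Longrightarrow> \<Delta> \<turnstile> Falsum"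
  shows "\<Gamma> \<turnstile> Falsum"
  using assms Neg_iff[of \<Gamma>] ImpE by metis

lemma Neg_contrapos:
  assumes "finite \<Gamma>" "\<Gamma> \<turnstile> Neg q" "\<And>\<Delta>. finite \<Delta> \<Longrightarrow> \<Delta> \<turnstile> p \<Longrightarrow> \<Delta> \<turnstile> Neg (Neg q)"
  shows "\<Gamma> \<turnstile> Neg p"
  unfolding Neg_iff[OF assms(1)] using assms(2,3) ImpE weakening by blast

text \<open>
  The case that matters most is an implication with \<open>Into\<close>: a weak passage back suffices for its
  premise because the translated conclusion is stable, so the remaining double negation can be
  absorbed there. This is how existential quantifiers in the premises of the axioms are handled.
\<close>

lemma transfers_sound:
  "(\<forall>\<Gamma>. finite \<Gamma> \<longrightarrow> transfers Into p \<longrightarrow> \<Gamma> \<turnstile> p \<longrightarrow> \<Gamma> \<turnstile> negtr p)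
   \<and> (\<forall>\<Gamma>. finite \<Gamma> \<longrightarrow> transfers Out_weak p \<longrightarrow> \<Gamma> \<turnstile> negtr p \<longrightarrow> \<Gamma> \<turnstile> Neg (Neg p))
   \<and> (\<forall>\<Gamma>. finite \<Gamma> \<longrightarrow> transfers Out p \<longrightarrow> \<Gamma> \<turnstile> negtr p \<longrightarrow> \<Gamma> \<turnstile> p)"
proof (induction p rule: measure_induct_rule[where f = size])
  case (less p)
  have P: "\<Gamma> \<turnstile> negtr q" if "size q < size p" "finite \<Gamma>" "transfers Into q" "\<Gamma> \<turnstile> q" for q \<Gamma> using less that by blast
  have W: "\<Gamma> \<turnstile> Neg (Neg q)" if "size q < size p" "finite \<Gamma>" "transfers Out_weak q" "\<Gamma> \<turnstile> negtr q" for q \<Gamma> using less that by blast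
  have S: "\<Gamma> \<turnstile> q" if "size q < size p" "finite \<Gamma>" "transfers Out q" "\<Gamma> \<turnstile> negtr q" for q \<Gamma> using less that by blast
  note mono = weakening
  show ?case
  proof (intro conjI allI impI)
    fix \<Gamma> :: "fm set" assume fin: "finite \<Gamma>" and pol: "transfers Into p" and d: "\<Gamma> \<turnstile> p"
    show "\<Gamma> \<turnstile> negtr p"
    proof (cases p)
      case (Disj a b)
      show ?thesis unfolding Disj negtr.simps Neg_iff[OF fin] Conj_iff
      proof safe
        fix \<Delta> assume D: "finite \<Delta>" "\<Gamma> \<subseteq> \<Delta>" "\<Delta> \<turnstile> Neg (negtr a)" "\<Delta> \<turnstile> Neg (negtr b)"
        have "\<Delta> \<turnstile> Neg a" "\<Delta> \<turnstile> Neg b"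
          using D P[of a] P[of b] pol by (simp_all add: Disj Neg_iff)
        then show "\<Delta> \<turnstile> Falsum" using Disj_Neg[OF D(1)] mono[OF d D(2,1)] by (simp add: Disj)
      qed
    next
      case (Imp a b)
      show ?thesis unfolding Imp negtr.simps Imp_iff[OF fin]
      proof safe
        fix \<Delta> assume D: "finite \<Delta>" "\<Gamma> \<subseteq> \<Delta>" "\<Delta> \<turnstile> negtr a"
        have nn: "\<Delta> \<turnstile> Neg (Neg a)" using W[of a] D pol by (simp add: Imp)
        show "\<Delta> \<turnstile> negtr b"
        proof (intro negtr_stable Neg_NegI D)
          fix \<Theta> assume T: "finite \<Theta>" "\<Delta> \<subseteq> \<Theta>" "\<Theta> \<turnstile> Neg (negtr b)"
          show "\<Theta> \<turnstile> Falsum"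
          proof (rule Neg_NegE[OF T(1) mono[OF nn T(2,1)]])
            fix \<Omega> assume O: "finite \<Omega>" "\<Theta> \<subseteq> \<Omega>" "\<Omega> \<turnstile> a"
            have "\<Omega> \<turnstile> b" using mono[OF d _ O(1)] O D T by (auto simp: Imp intro: ImpE)
            then have "\<Omega> \<turnstile> negtr b" using P[of b] O pol by (simp add: Imp)
            then show "\<Omega> \<turnstile> Falsum" using mono[OF T(3) O(2,1)] ImpE by blast
          qed
        qed
      qed
    next
      case (Forall a)
      then show ?thesis using P[of "inst 0 _ a"] d fin pol by (auto simp: Forall_iff negtr_inst)
    next
      case (Exists a)
      show ?thesis unfolding Exists negtr.simps Neg_iff[OF fin]
      proof safe
        fix \<Delta> assume D: "finite \<Delta>" "\<Gamma> \<subseteq> \<Delta>" "\<Delta> \<turnstile> Forall (Neg (negtr a))"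
        have "\<Delta> \<turnstile> Neg (inst 0 x a)" for x
        proof -
          have "\<Delta> \<turnstile> Neg (negtr (inst 0 x a))" using D Forall_iff[OF D(1), of "Neg (negtr a)"] by (simp add: negtr_inst)
          then show ?thesis using P[of "inst 0 x a"] D pol by (simp add: Exists Neg_iff)
        qed
        then show "\<Delta> \<turnstile> Falsum" using Exists_Neg[OF D(1)] mono[OF d D(2,1)] by (simp add: Exists)
      qed
    qed (use fin d pol P in \<open>auto simp: Conj_iff intro: double_neg\<close>)
  next
    fix \<Gamma> :: "fm set" assume fin: "finite \<Gamma>" and pol: "transfers Out_weak p" and d: "\<Gamma> \<turnstile> negtr p"
    show "\<Gamma> \<turnstile> Neg (Neg p)"
    proof (cases p)
      case (Conj a b)
      have nn: "\<Gamma> \<turnstile> Neg (Neg a)" "\<Gamma> \<turnstile> Neg (Neg b)" using W[of a] W[of b] fin pol d by (auto simp: Conj Conj_iff)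
      show ?thesis
      proof (rule Neg_NegI[OF fin])
        fix \<Delta> assume D: "finite \<Delta>" "\<Gamma> \<subseteq> \<Delta>" "\<Delta> \<turnstile> Neg p"
        show "\<Delta> \<turnstile> Falsum"
        proof (rule Neg_NegE[OF D(1) mono[OF nn(1) D(2,1)]])
          fix \<Theta> assume T: "finite \<Theta>" "\<Delta> \<subseteq> \<Theta>" "\<Theta> \<turnstile> a"
          show "\<Theta> \<turnstile> Falsum"
          proof (rule Neg_NegE[OF T(1)])
            show "\<Theta> \<turnstile> Neg (Neg b)" using mono[OF nn(2) _ T(1)] D T by auto
            fix \<Omega> assume O: "finite \<Omega>" "\<Theta> \<subseteq> \<Omega>" "\<Omega> \<turnstile> b"
            have "\<Omega> \<turnstile> p" using mono[OF T(3) O(2,1)] O by (simp add: Conj Conj_iff)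
            then show "\<Omega> \<turnstile> Falsum" using mono[OF D(3) _ O(1)] T O ImpE by blast
          qed
        qed
      qed
    next
      case (Disj a b)
      show ?thesis
      proof (rule Neg_NegI[OF fin])
        fix \<Delta> assume D: "finite \<Delta>" "\<Gamma> \<subseteq> \<Delta>" "\<Delta> \<turnstile> Neg p"
        have "\<Delta> \<turnstile> Neg a" "\<Delta> \<turnstile> Neg b"
          using D by (auto simp: Disj Neg_iff intro: DisjI1 DisjI2)
        then have "\<Delta> \<turnstile> Neg (negtr a)" "\<Delta> \<turnstile> Neg (negtr b)"
          using W[of a] W[of b] pol D(1) Neg_contrapos[of \<Delta> a "negtr a"] Neg_contrapos[of \<Delta> b "negtr b"]
          by (simp_all add: Disj)
        then show "\<Delta> \<turnstile> Falsum" using mono[OF d D(2,1)] by (auto simp: Disj intro: ImpE ConjI)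
      qed
    next
      case (Imp a b)
      show ?thesis
      proof (rule Neg_NegI[OF fin])
        fix \<Delta> assume D: "finite \<Delta>" "\<Gamma> \<subseteq> \<Delta>" "\<Delta> \<turnstile> Neg p"
        have nb: "\<Delta> \<turnstile> Neg b" unfolding Neg_iff[OF D(1)]
        proof safe
          fix \<Theta> assume T: "finite \<Theta>" "\<Delta> \<subseteq> \<Theta>" "\<Theta> \<turnstile> b"
          then have "\<Theta> \<turnstile> p" using mono by (auto simp: Imp Imp_iff)
          then show "\<Theta> \<turnstile> Falsum" using mono[OF D(3) T(2,1)] ImpE by blast
        qed
        have "\<Delta> \<turnstile> p" unfolding Imp Imp_iff[OF D(1)]
        proof safe
          fix \<Theta> assume T: "finite \<Theta>" "\<Delta> \<subseteq> \<Theta>" "\<Theta> \<turnstile> a"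
          have "\<Theta> \<turnstile> negtr a" using P[of a] T pol by (simp add: Imp)
          then have "\<Theta> \<turnstile> negtr b" using mono[OF d _ T(1)] D T by (auto simp: Imp intro: ImpE)
          then have "\<Theta> \<turnstile> Neg (Neg b)" using W[of b] T pol by (simp add: Imp)
          then have "\<Theta> \<turnstile> Falsum" using mono[OF nb T(2,1)] ImpE by blast
          then show "\<Theta> \<turnstile> b" by (rule FalsumE)
        qed
        then show "\<Delta> \<turnstile> Falsum" using D(3) ImpE by blast
      qed
    next
      case (Exists a)
      show ?thesis
      proof (rule Neg_NegI[OF fin])
        fix \<Delta> assume D: "finite \<Delta>" "\<Gamma> \<subseteq> \<Delta>" "\<Delta> \<turnstile> Neg p"
        have "\<Delta> \<turnstile> Neg (negtr (inst 0 x a))" for x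
        proof -
          have n: "\<Delta> \<turnstile> Neg (inst 0 x a)"
            using D by (auto simp: Exists Neg_iff intro: ExistsI)
          show ?thesis unfolding Neg_iff[OF D(1)]
          proof safe
            fix \<Theta> assume T: "finite \<Theta>" "\<Delta> \<subseteq> \<Theta>" "\<Theta> \<turnstile> negtr (inst 0 x a)"
            then have "\<Theta> \<turnstile> Neg (Neg (inst 0 x a))" using W[of "inst 0 x a"] pol by (simp add: Exists)
            then show "\<Theta> \<turnstile> Falsum" using mono[OF n T(2,1)] ImpE by blast
          qed
        qed
        then have "\<Delta> \<turnstile> Forall (Neg (negtr a))" using D(1) by (simp add: Forall_iff negtr_inst)
        then show "\<Delta> \<turnstile> Falsum" using mono[OF d D(2,1)] by (auto simp: Exists intro: ImpE)
      qed
    qed (use fin d pol in \<open>auto intro: double_neg\<close>)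
  next
    fix \<Gamma> :: "fm set" assume fin: "finite \<Gamma>" and pol: "transfers Out p" and d: "\<Gamma> \<turnstile> negtr p"
    show "\<Gamma> \<turnstile> p"
    proof (cases p)
      case (Imp a b)
      then show ?thesis using fin d pol P[of a] S[of b] by (auto simp: Imp_iff)
    next
      case (Forall a)
      then show ?thesis using S[of "inst 0 _ a"] d fin pol by (auto simp: Forall_iff negtr_inst)
    qed (use fin d pol S in \<open>auto simp: Conj_iff\<close>)
  qed
qed


section \<open>Truth sets of classical structures\<close>

instance tm :: countable by countable_datatype
instance fm :: countable by countable_datatype

text \<open>
  Consistency of the translations in intuitionistic logic, that is, consistency in classical
  logic. It is meant for finite sets, which always leave fresh parameters.
\<close>

definition consistent :: "fm set \<Rightarrow> bool" where "consistent F \<longleftrightarrow> \<not> negtr ` F \<turnstile> Falsum"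

definition witness :: "fm \<Rightarrow> fm set \<Rightarrow> fm set" where
  "witness p F = (case p of Exists q \<Rightarrow> {inst 0 (SOME x. \<forall>r\<in>insert p F. x \<notin> params r) q} | _ \<Rightarrow> {})"

definition extend :: "fm \<Rightarrow> fm set \<Rightarrow> fm set" where
  "extend p F = (if consistent (insert p F) then insert p F \<union> witness p F else insert (Neg p) F)"

fun chain :: "fm set \<Rightarrow> nat \<Rightarrow> fm set" where
  "chain F 0 = F"
| "chain F (Suc n) = extend (from_nat n) (chain F n)"

text \<open>
  The set of formulas true in a classical structure all of whose elements are named by parameters. A
  quantifier is decided by its instances, so membership of a concrete sentence can be computed
  without an evaluation function or environments.
\<close>

locale truth_set =
  fixes S :: "fm set"
  assumes Falsum: "Falsum \<notin> S"
    and Conj: "Conj p q \<in> S \<longleftrightarrow> p \<in> S \<and> q \<in> S"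
    and Disj: "Disj p q \<in> S \<longleftrightarrow> p \<in> S \<or> q \<in> S"
    and Imp: "Imp p q \<in> S \<longleftrightarrow> (p \<in> S \<longrightarrow> q \<in> S)"
    and Forall: "Forall p \<in> S \<longleftrightarrow> (\<forall>x. inst 0 x p \<in> S)"
    and Exists: "Exists p \<in> S \<longleftrightarrow> (\<exists>x. inst 0 x p \<in> S)"
    and Eq_refl: "Eq (Par x) (Par x) \<in> S"
    and Eq_subst: "Eq (Par x) (Par y) \<in> S \<Longrightarrow> inst 0 x p \<in> S \<Longrightarrow> inst 0 y p \<in> S"

lemma finite_witness: "finite (witness p F)" by (cases p) (auto simp: witness_def)

lemma finite_chain: "finite F \<Longrightarrow> finite (chain F n)"
  by (induction n) (auto simp: extend_def finite_witness)

text \<open>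
  A Henkin witness keeps the set consistent: if the instance at a fresh parameter is refutable, so
  is every instance, and the translated existential formula is the negation of just that.
\<close>

lemma consistent_extend:
  assumes fin: "finite F" and consistent: "consistent F"
  shows "consistent (extend p F)"
proof (cases "consistent (insert p F)")
  case False
  then have "negtr ` F \<turnstile> Neg (negtr p)" by (auto simp: consistent_def intro: ImpI)
  then have "\<not> insert (Neg (negtr p)) (negtr ` F) \<turnstile> Falsum" using consistent cut consistent_def by blast
  then show ?thesis using False by (simp add: extend_def consistent_def)
next
  case True
  show ?thesis
  proof (cases "\<exists>q. p = Exists q")
    case False
    then have "witness p F = {}" by (cases p) (auto simp: witness_def)
    then show ?thesis using True by (simp add: extend_def)
  next
    case ex: True
    then obtain q where q: "p = Exists q" by blast
    define x where "x = (SOME x. \<forall>r\<in>insert p F. x \<notin> params r)"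
    have x: "\<forall>r\<in>insert p F. x \<notin> params r"
      unfolding x_def by (rule someI_ex, rule fresh_param) (simp add: fin)
    let ?G = "negtr ` insert p F"
    have "\<not> insert (negtr (inst 0 x q)) ?G \<turnstile> Falsum"
    proof
      assume "insert (negtr (inst 0 x q)) ?G \<turnstile> Falsum"
      then have "?G \<turnstile> inst 0 x (Neg (negtr q))" by (auto simp: negtr_inst intro: ImpI)
      moreover have "x \<notin> params (Neg (negtr q))" "\<forall>r\<in>?G. x \<notin> params r"
        using x by (auto simp: q params_negtr)
      ultimately have "?G \<turnstile> Forall (Neg (negtr q))" by (rule ForallI)
      moreover have "?G \<turnstile> negtr p" by (rule Assm) auto
      ultimately have "?G \<turnstile> Falsum" by (auto simp: q intro: ImpE)
      then show False using True by (simp add: consistent_def)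
    qed
    moreover have "extend p F = insert (inst 0 x q) (insert p F)"
      using True by (simp add: extend_def witness_def q x_def)
    ultimately show ?thesis by (simp add: consistent_def)
  qed
qed

lemma consistent_chain: "finite F \<Longrightarrow> consistent F \<Longrightarrow> consistent (chain F n)"
  by (induction n) (auto simp: consistent_extend finite_chain)

lemma chain_mono: "m \<le> n \<Longrightarrow> chain F m \<subseteq> chain F n"
  by (rule lift_Suc_mono_le[of "chain F"]) (auto simp: extend_def)

text \<open>
  The union of the chain decides every formula and has witnesses, hence contains every formula
  whose translation is derivable from translations of its members. The clauses of a truth set are
  thereby reduced to small derivations between translated formulas.
\<close>

lemma truth_set_exists:
  assumes fin: "finite F" and consistent: "consistent F"
  shows "\<exists>S. truth_set S \<and> F \<subseteq> S"
proof -
  define S where "S = (\<Union>n. chain F n)"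
  have FS: "F \<subseteq> S" unfolding S_def by (rule UN_upper[of 0 UNIV "chain F", simplified])
  have fin_sub: "\<exists>n. G \<subseteq> chain F n" if "finite G" "G \<subseteq> S" for G
    using that
  proof (induction G)
    case (insert p G)
    then obtain m n where "G \<subseteq> chain F m" "p \<in> chain F n" by (auto simp: S_def)
    then show ?case using chain_mono[of m "max m n" F] chain_mono[of n "max m n" F] by (intro exI[of _ "max m n"]) auto
  qed auto
  have conS: "\<not> negtr ` G \<turnstile> Falsum" if G: "finite G" "G \<subseteq> S" for G
  proof
    assume a: "negtr ` G \<turnstile> Falsum"
    obtain n where "G \<subseteq> chain F n" using fin_sub[OF G] by blast
    then have "negtr ` chain F n \<turnstile> Falsum" using weakening[OF a] finite_chain[OF fin] by (meson finite_imageI image_mono)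
    then show False using consistent_chain[OF fin consistent] by (auto simp: consistent_def)
  qed
  have total: "p \<in> S \<or> Neg p \<in> S" and wit: "\<And>q. p = Exists q \<Longrightarrow> p \<in> S \<Longrightarrow> \<exists>x. inst 0 x q \<in> S" for p
  proof -
    let ?n = "to_nat p"
    have sub: "chain F (Suc ?n) \<subseteq> S" unfolding S_def by (rule UN_upper) simp
    have e: "chain F (Suc ?n) = extend p (chain F ?n)" by simp
    show "p \<in> S \<or> Neg p \<in> S" using sub unfolding e by (auto simp: extend_def split: if_splits)
    show "\<exists>x. inst 0 x q \<in> S" if q: "p = Exists q" and pS: "p \<in> S" for q
    proof (cases "consistent (insert p (chain F ?n))")
      case True
      then show ?thesis using sub unfolding e by (auto simp: extend_def q witness_def)
    next
      case False
      then have "Neg p \<in> S" using sub unfolding e by (auto simp: extend_def)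
      then have "\<not> negtr ` {p, Neg p} \<turnstile> Falsum" using conS[of "{p, Neg p}"] pS by auto
      moreover have "negtr ` {p, Neg p} \<turnstile> Falsum" by (auto intro: ImpE[of _ "negtr p"] Assm)
      ultimately show ?thesis by simp
    qed
  qed
  have closed: "p \<in> S" if "finite G" "G \<subseteq> S" "negtr ` G \<turnstile> negtr p" for G p
  proof (rule ccontr)
    assume "p \<notin> S"
    then have n: "Neg p \<in> S" using total by blast
    let ?H = "insert (Neg p) G"
    have "negtr ` ?H \<turnstile> negtr p" using that weakening[of "negtr ` G" "negtr p" "negtr ` ?H"] by auto
    then have "negtr ` ?H \<turnstile> Falsum" by (auto intro: ImpE[of _ "negtr p"] Assm)
    then show False using conS[of ?H] n that by auto
  qed
  \<comment> \<open>Closure under rules with at most two premises, in the form in which it is applied.\<close>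
  have cl0: "p \<in> S" if "\<And>\<Gamma>. finite \<Gamma> \<Longrightarrow> \<Gamma> \<turnstile> negtr p" for p
    using closed[of "{}" p] that by auto
  have cl1: "p \<in> S" if "q \<in> S" "\<And>\<Gamma>. finite \<Gamma> \<Longrightarrow> \<Gamma> \<turnstile> negtr q \<Longrightarrow> \<Gamma> \<turnstile> negtr p" for p q
    by (rule closed[of "{q}"]) (use that(1) in \<open>auto intro!: that(2) intro: Assm\<close>)
  have cl2: "p \<in> S" if "q \<in> S" "r \<in> S" "\<And>\<Gamma>. finite \<Gamma> \<Longrightarrow> \<Gamma> \<turnstile> negtr q \<Longrightarrow> \<Gamma> \<turnstile> negtr r \<Longrightarrow> \<Gamma> \<turnstile> negtr p" for p q r
    by (rule closed[of "{q, r}"]) (use that(1,2) in \<open>auto intro!: that(3) intro: Assm\<close>)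
  have fal: "Falsum \<notin> S" using conS[of "{Falsum}"] by (auto intro: Assm)
  have neg: "Neg p \<in> S \<longleftrightarrow> p \<notin> S" for p
    using total[of p] cl2[of p "Neg p" Falsum] fal by (auto intro: ImpE)
  have imp: "Imp p q \<in> S \<longleftrightarrow> (p \<in> S \<longrightarrow> q \<in> S)" for p q
  proof
    assume "Imp p q \<in> S" then show "p \<in> S \<longrightarrow> q \<in> S" using cl2[of p "Imp p q" q] by (auto intro: ImpE)
  next
    assume "p \<in> S \<longrightarrow> q \<in> S"
    then consider "Neg p \<in> S" | "q \<in> S" using neg by blast
    then show "Imp p q \<in> S"
    proof cases
      case 1 then show ?thesis by (rule cl1) (auto simp: Imp_iff intro: FalsumE)
    next
      case 2 then show ?thesis by (rule cl1) (auto simp: Imp_iff intro: weakening)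
    qed
  qed
  have conj: "Conj p q \<in> S \<longleftrightarrow> p \<in> S \<and> q \<in> S" for p q
    using cl1[of "Conj p q" p] cl1[of "Conj p q" q] cl2[of p q "Conj p q"] by (auto simp: Conj_iff)
  have disj: "Disj p q \<in> S \<longleftrightarrow> p \<in> S \<or> q \<in> S" for p q
  proof -
    have "Disj p q \<in> S \<longleftrightarrow> Neg (Conj (Neg p) (Neg q)) \<in> S"
      using cl1[of "Disj p q" "Neg (Conj (Neg p) (Neg q))"] cl1[of "Neg (Conj (Neg p) (Neg q))" "Disj p q"] by auto
    then show ?thesis by (auto simp: neg conj)
  qed
  have exi: "inst 0 x p \<in> S \<Longrightarrow> Exists p \<in> S" for x p
  proof (erule cl1)
    fix \<Gamma> assume G: "finite \<Gamma>" "\<Gamma> \<turnstile> negtr (inst 0 x p)"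
    show "\<Gamma> \<turnstile> negtr (Exists p)"
      unfolding negtr.simps Neg_iff[OF G(1)]
    proof safe
      fix \<Delta> assume D: "finite \<Delta>" "\<Gamma> \<subseteq> \<Delta>" "\<Delta> \<turnstile> Forall (Neg (negtr p))"
      have "\<Delta> \<turnstile> inst 0 x (Neg (negtr p))" using D(3) by (rule ForallE)
      then show "\<Delta> \<turnstile> Falsum" using weakening[OF G(2) D(2,1)] by (auto simp: negtr_inst intro: ImpE)
    qed
  qed
  have ex: "Exists p \<in> S \<longleftrightarrow> (\<exists>x. inst 0 x p \<in> S)" for p
    using exi wit by blast
  have all: "Forall p \<in> S \<longleftrightarrow> (\<forall>x. inst 0 x p \<in> S)" for p
  proof
    assume "Forall p \<in> S"
    then show "\<forall>x. inst 0 x p \<in> S" by (auto elim!: cl1 simp: negtr_inst intro: ForallE)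
  next
    assume a: "\<forall>x. inst 0 x p \<in> S"
    show "Forall p \<in> S"
    proof (rule ccontr)
      assume "Forall p \<notin> S"
      then have "Neg (Forall p) \<in> S" using neg by blast
      then have "Exists (Neg p) \<in> S"
      proof (rule cl1)
        fix \<Gamma> assume G: "finite \<Gamma>" "\<Gamma> \<turnstile> negtr (Neg (Forall p))"
        show "\<Gamma> \<turnstile> negtr (Exists (Neg p))" unfolding negtr.simps Neg_iff[OF G(1)]
        proof safe
          fix \<Delta> assume D: "finite \<Delta>" "\<Gamma> \<subseteq> \<Delta>" "\<Delta> \<turnstile> Forall (Neg (Neg (negtr p)))"
          have "\<Delta> \<turnstile> negtr (inst 0 x p)" for x
            using D Forall_iff[OF D(1)] by (intro negtr_stable) (auto simp: negtr_inst)
          then have "\<Delta> \<turnstile> negtr (Forall p)" using D by (auto simp: negtr_inst Forall_iff)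
          then show "\<Delta> \<turnstile> Falsum" using weakening[OF G(2) D(2,1)] by (auto intro: ImpE)
        qed
      qed
      then show False using ex a neg by auto
    qed
  qed
  have eq: "Eq (Par x) (Par x) \<in> S" for x
    by (rule cl0) (auto intro: double_neg EqRefl)
  have subst: "inst 0 y p \<in> S" if "Eq (Par x) (Par y) \<in> S" "inst 0 x p \<in> S" for x y p
    using that
  proof (rule cl2)
    fix \<Gamma> assume G: "finite \<Gamma>" "\<Gamma> \<turnstile> negtr (Eq (Par x) (Par y))" "\<Gamma> \<turnstile> negtr (inst 0 x p)"
    show "\<Gamma> \<turnstile> negtr (inst 0 y p)"
    proof (intro negtr_stable Neg_NegI G)
      fix \<Delta> assume D: "finite \<Delta>" "\<Gamma> \<subseteq> \<Delta>" "\<Delta> \<turnstile> Neg (negtr (inst 0 y p))"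
      have "\<Delta> \<turnstile> Neg (Neg (Eq (Par x) (Par y)))" using weakening[OF G(2) D(2,1)] by simp
      then show "\<Delta> \<turnstile> Falsum"
      proof (rule Neg_NegE[OF D(1)])
        fix \<Theta> assume T: "finite \<Theta>" "\<Delta> \<subseteq> \<Theta>" "\<Theta> \<turnstile> Eq (Par x) (Par y)"
        have "\<Theta> \<turnstile> inst 0 x (negtr p)" using weakening[OF G(3) _ T(1)] D T by (auto simp: negtr_inst)
        then have "\<Theta> \<turnstile> negtr (inst 0 y p)" using EqSubst[OF T(3)] by (simp add: negtr_inst)
        then show "\<Theta> \<turnstile> Falsum" using weakening[OF D(3) T(2,1)] ImpE by blast
      qed
    qed
  qed
  have "truth_set S"
    by (rule truth_set.intro; (rule fal conj disj imp all ex eq)?; (erule subst, assumption)?)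
  then show ?thesis using FS by blast
qed

text \<open>
  If the translation of the conclusion were not derivable from the translated premises, adding its
  negation would be consistent and yield a truth set against the hypothesis. The premises imply
  their translations, and the translated conclusion implies the conclusion.
\<close>

theorem classical_semantics_suffices:
  assumes fin: "finite \<Gamma>" and pos: "\<And>p. p \<in> \<Gamma> \<Longrightarrow> transfers Into p" and neg: "transfers Out q"
    and sem: "\<And>S. truth_set S \<Longrightarrow> \<Gamma> \<subseteq> S \<Longrightarrow> q \<in> S"
  shows "\<Gamma> \<turnstile> q"
proof -
  have "negtr ` insert (Neg q) \<Gamma> \<turnstile> Falsum"
  proof (rule ccontr)
    assume "\<not> ?thesis"
    then have "consistent (insert (Neg q) \<Gamma>)" by (simp add: consistent_def)
    then obtain S where "truth_set S" "insert (Neg q) \<Gamma> \<subseteq> S" using truth_set_exists fin by blast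
    then show False using sem[of S] truth_set.Imp[of S q Falsum] truth_set.Falsum[of S] by auto
  qed
  then have "negtr ` \<Gamma> \<turnstile> Neg (Neg (negtr q))" by (auto intro: ImpI)
  then have "negtr ` \<Gamma> \<turnstile> negtr q" using fin by (auto intro: negtr_stable)
  then have "negtr ` \<Gamma> \<union> \<Gamma> \<turnstile> negtr q" using fin by (auto intro: weakening)
  moreover have "\<Gamma> \<turnstile> negtr p" if "p \<in> \<Gamma>" for p using that fin pos[OF that] transfers_sound[of p] by (blast intro: Assm)
  ultimately have "\<Gamma> \<turnstile> negtr q" using cut_set[of "negtr ` \<Gamma>" \<Gamma>] fin by auto
  then show ?thesis using transfers_sound neg fin by blast
qed


section \<open>Neutral planes, classically\<close>

locale betw_cong =
  fixes Bt :: "'a \<Rightarrow> 'a \<Rightarrow> 'a \<Rightarrow> bool" and C :: "'a \<Rightarrow> 'a \<Rightarrow> 'a \<Rightarrow> 'a \<Rightarrow> bool"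
begin

definition Bet :: "'a \<Rightarrow> 'a \<Rightarrow> 'a \<Rightarrow> bool" where
  "Bet a b c \<longleftrightarrow> a = b \<or> b = c \<or> Bt a b c"

definition online :: "'a \<Rightarrow> 'a \<Rightarrow> 'a \<Rightarrow> bool" where
  "online x a b \<longleftrightarrow> Bt a b x \<or> Bt b x a \<or> Bt x a b \<or> x = a \<or> x = b"

definition collin :: "'a \<Rightarrow> 'a \<Rightarrow> 'a \<Rightarrow> bool" where
  "collin a b c \<longleftrightarrow> (\<exists>u v. u \<noteq> v \<and> online a u v \<and> online b u v \<and> online c u v)"

end

text \<open>
  The axioms as a classical structure satisfies them. A structure with a single point satisfies the
  sentences too: it has no lines, so nothing in it is collinear. Two distinct points are provided by
  any line that Playfair's axiom speaks about.
\<close>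

locale neutral_plane = betw_cong +
  assumes C_swap: "C a b b a"
    and C_inner_trans: "C a b p q \<Longrightarrow> C a b r s \<Longrightarrow> C p q r s"
    and C_null: "C a b c c \<Longrightarrow> a = b"
    and extension: "a \<noteq> b \<Longrightarrow> \<exists>x. Bet a b x \<and> C b x c d"
    and five_segment: "a \<noteq> b \<Longrightarrow> Bet a b c \<Longrightarrow> Bet a' b' c' \<Longrightarrow> C a b a' b' \<Longrightarrow> C b c b' c' \<Longrightarrow>
      C a d a' d' \<Longrightarrow> C b d b' d' \<Longrightarrow> C c d c' d'"
    and Bt_sym: "Bt a b c \<Longrightarrow> Bt c b a"
    and Bt_distinct: "Bt a b c \<Longrightarrow> a \<noteq> b \<and> b \<noteq> c"
    and Bt_irrefl: "\<not> Bt a b a"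
    and Bet_inner: "Bet a b d \<Longrightarrow> Bet b c d \<Longrightarrow> Bet a b c \<and> Bet a c d"
    and Bet_outer: "Bet a b c \<Longrightarrow> Bet b c d \<Longrightarrow> b \<noteq> c \<Longrightarrow> Bet a c d \<and> Bet a b d"
    and Bt_connected: "Bt a b c \<Longrightarrow> Bt a b d \<Longrightarrow> Bet a c d \<or> Bet a d c"
    and strict_pasch: "\<not> collin a b c \<Longrightarrow> Bt a p c \<Longrightarrow> Bt b q c \<Longrightarrow> \<exists>x. Bt p x b \<and> Bt q x a"
    and two_points: "\<exists>a b :: 'a. a \<noteq> b"
    and upper_dim: "p \<noteq> q \<Longrightarrow> C a p a q \<Longrightarrow> C b p b q \<Longrightarrow> C c p c q \<Longrightarrow> collin a b c"
    and circle_circle: "c \<noteq> c' \<Longrightarrow> C c p r s \<Longrightarrow> Bet r' e s' \<Longrightarrow> C c' p r' e \<Longrightarrow>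
      C c q r s \<Longrightarrow> Bet c' e' q \<Longrightarrow> C r' s' c' e' \<Longrightarrow> \<exists>x. C c x r s \<and> C c' x r' s'"
begin

text \<open>
  The congruence class of a segment serves as its length, so that congruences become equations and
  their symmetry and transitivity those of equality.
\<close>

definition len :: "'a \<Rightarrow> 'a \<Rightarrow> ('a \<times> 'a) set" where
  "len a b = {(x, y). C a b x y}"

lemma C_iff: "C a b c d \<longleftrightarrow> len a b = len c d"
proof -
  have refl: "C x y x y" for x y using C_swap C_inner_trans by blast
  have sym: "C x y z w \<Longrightarrow> C z w x y" for x y z w using refl C_inner_trans by blast
  show ?thesis
  proof
    assume "C a b c d"
    then have "C a b x y \<longleftrightarrow> C c d x y" for x y using sym C_inner_trans by blast
    then show "len a b = len c d" by (auto simp: len_def)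
  next
    assume "len a b = len c d"
    then show "C a b c d" using refl[of c d] by (auto simp: len_def)
  qed
qed

lemma len_commute: "len a b = len b a" using C_swap C_iff by blast

lemma len_nullD: "len a b = len c c \<Longrightarrow> a = b" using C_null C_iff by blast

lemma len_null: "len a a = len b b"
proof (cases "a = b")
  case False
  then obtain x where "Bet a b x" "len b x = len a a" using extension[of a b a a] C_iff by blast
  then show ?thesis using len_nullD by metis
qed simp

lemma five_seg: "a \<noteq> b \<Longrightarrow> Bet a b c \<Longrightarrow> Bet a' b' c' \<Longrightarrow> len a b = len a' b' \<Longrightarrow> len b c = len b' c' \<Longrightarrow>
      len a d = len a' d' \<Longrightarrow> len b d = len b' d' \<Longrightarrow> len c d = len c' d'"
  using five_segment[of a b c a' b' c' d d'] C_iff[of a b a' b'] C_iff[of b c b' c'] C_iff[of a d a' d'] C_iff[of b d b' d'] C_iff[of c d c' d'] by fast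

section \<open>Betweenness\<close>

lemma Bet_trivial [simp]: "Bet a a b" "Bet a b b" by (auto simp: Bet_def)

lemma Bet_sym: "Bet a b c \<Longrightarrow> Bet c b a" using Bt_sym by (auto simp: Bet_def)

lemma Bet_identity: "Bet a b a \<Longrightarrow> a = b" using Bt_irrefl by (auto simp: Bet_def)

lemma Bet_inner1: "Bet a b d \<Longrightarrow> Bet b c d \<Longrightarrow> Bet a b c" using Bet_inner by blast
lemma Bet_inner2: "Bet a b d \<Longrightarrow> Bet b c d \<Longrightarrow> Bet a c d" using Bet_inner by blast
lemma Bet_inner3: "Bet a c d \<Longrightarrow> Bet a b c \<Longrightarrow> Bet b c d" by (meson Bet_inner1 Bet_sym)
lemma Bet_inner4: "Bet a c d \<Longrightarrow> Bet a b c \<Longrightarrow> Bet a b d" by (meson Bet_inner2 Bet_sym)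
lemma Bet_outer2: "Bet a b c \<Longrightarrow> Bet b c d \<Longrightarrow> b \<noteq> c \<Longrightarrow> Bet a b d" using Bet_outer by blast

lemma Bet_antisym: "Bet a b c \<Longrightarrow> Bet b a c \<Longrightarrow> a = b"
  using Bet_inner1[of a b c a] Bet_identity Bet_inner1[of b a c b] Bet_inner1[of a b a c] by (metis Bet_inner1 Bet_identity)

lemma Bet_connected1: "a \<noteq> b \<Longrightarrow> Bet a b c \<Longrightarrow> Bet a b d \<Longrightarrow> Bet a c d \<or> Bet a d c"
  using Bt_connected[of a b c d] Bet_def[of a b c] Bet_def[of a b d] Bet_def[of a c d] Bet_def[of a d c] by blast

lemma Bet_connected2: "a \<noteq> b \<Longrightarrow> Bet a b c \<Longrightarrow> Bet a b d \<Longrightarrow> Bet b c d \<or> Bet b d c"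
  using Bet_connected1[of a b c d] Bet_inner3[of a c d b] Bet_inner3[of a d c b] by blast

lemma other_point: "\<exists>b. b \<noteq> (a::'a)" using two_points by metis

lemma segment_construction: "\<exists>x. Bet a b x \<and> len b x = len c d"
proof (cases "a = b")
  case True
  obtain z where "z \<noteq> b" using other_point by blast
  then show ?thesis using extension[of z b c d] C_iff True by auto
qed (use extension C_iff in blast)

lemma proper_extension: "\<exists>x. Bet a b x \<and> x \<noteq> b"
proof -
  obtain z where z: "z \<noteq> b" using other_point by blast
  obtain x where "Bet a b x" "len b x = len b z" using segment_construction by blast
  then show ?thesis using z len_nullD len_null by metis
qed

lemma Bet_connected3: "Bet a b d \<Longrightarrow> Bet a c d \<Longrightarrow> Bet a b c \<or> Bet a c b"
proof -
  assume h: "Bet a b d" "Bet a c d"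
  obtain e where e: "Bet d a e" "e \<noteq> a" using proper_extension by blast
  then have "Bet e a b" "Bet e a c" using h Bet_sym Bet_inner1 by meson+
  then show ?thesis using e(2) Bet_connected2 by blast
qed

section \<open>Congruence\<close>

lemma sum_segments:
  assumes "Bet a b c" "Bet a' b' c'" "len a b = len a' b'" "len b c = len b' c'"
  shows "len a c = len a' c'"
proof (cases "a = b")
  case True
  then have "a' = b'" using assms len_nullD by metis
  then show ?thesis using True assms by simp
next
  case False
  then show ?thesis using five_seg[of a b c a' b' c' a a'] assms len_commute len_null by metis
qed

lemma construction_unique:
  assumes "q \<noteq> a" "Bet q a x" "Bet q a y" "len a x = len a y"
  shows "x = y"
proof -
  have "len q x = len q y" using sum_segments[of q a x q a y] assms by simp
  then have "len x x = len x y"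
    using five_seg[of q a x q a x x y] assms by auto
  then show ?thesis using len_nullD by metis
qed

text \<open>
  Prolong both configurations beyond \<open>c\<close>: the five-segment axiom first carries the congruence to the
  new point and then, read from there, back to \<open>b\<close>.
\<close>

lemma inner_five_seg:
  assumes "Bet a b c" "Bet a' b' c'" "len a c = len a' c'" "len b c = len b' c'"
    "len a d = len a' d'" "len c d = len c' d'"
  shows "len b d = len b' d'"
proof (cases "a = c")
  case True
  then have "a' = c'" using assms len_nullD by metis
  then have "a = b" "a' = b'" using True assms Bet_identity by auto
  then show ?thesis using assms by simp
next
  case False
  obtain e where e: "Bet a c e" "e \<noteq> c" using proper_extension by blast
  obtain e' where e': "Bet a' c' e'" "len c' e' = len c e" using segment_construction by blast
  have "len e d = len e' d'" using five_seg[OF False e(1) e'(1)] assms e' by simp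
  moreover have "Bet e c b" "Bet e' c' b'" using e e' assms Bet_inner3 Bet_sym by blast+
  ultimately show ?thesis
    using five_seg[of e c b e' c' b' d d'] e e' assms len_commute by metis
qed

lemma Bet_same_len: assumes "Bet a b c" "len a b = len a c" shows "b = c"
proof -
  obtain z where z: "Bet c a z" "z \<noteq> a" using proper_extension by blast
  then have "Bet z a b" "Bet z a c" using assms Bet_sym Bet_inner1 by meson+
  then show ?thesis using construction_unique assms z by blast
qed

text \<open>
  Lay off the two parts from \<open>a'\<close> along the ray to \<open>c'\<close>; the end point is \<open>c'\<close> because a segment
  can be laid off on a ray in one way only.
\<close>

lemma transfer_between:
  assumes "Bet a b c" "len a c = len a' c'"
  obtains b' where "Bet a' b' c'" "len a b = len a' b'" "len b c = len b' c'"
proof -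
  obtain x where x: "Bet c' a' x" "x \<noteq> a'" using proper_extension by blast
  obtain b' where b': "Bet x a' b'" "len a' b' = len a b" using segment_construction by blast
  obtain c'' where c'': "Bet x b' c''" "len b' c'' = len b c" using segment_construction by blast
  have 1: "Bet a' b' c''" "Bet x a' c''" using b' c'' Bet_inner3 Bet_inner4 by blast+
  then have "len a' c'' = len a' c'" using sum_segments[of a' b' c'' a b c] b' c'' assms by simp
  then have "c'' = c'" using construction_unique[of x a' c'' c'] x 1 Bet_sym by blast
  then show thesis using that 1 b' c'' by auto
qed

lemma Bet_transfer:
  assumes "Bet a b c" "len a b = len a' b'" "len b c = len b' c'" "len a c = len a' c'"
  shows "Bet a' b' c'"
proof -
  obtain x where x: "Bet a' x c'" "len a b = len a' x" "len b c = len x c'"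
    using transfer_between assms by metis
  have "len x x = len x b'"
    using inner_five_seg[of a' x c' a' x c' x b'] x assms len_commute by metis
  then show ?thesis using x len_nullD by metis
qed

definition Col :: "'a \<Rightarrow> 'a \<Rightarrow> 'a \<Rightarrow> bool" where
  "Col a b c \<longleftrightarrow> Bet a b c \<or> Bet b c a \<or> Bet c a b"

lemma Col_perms: "Col a b c \<Longrightarrow> Col b a c" "Col a b c \<Longrightarrow> Col b c a" "Col a b c \<Longrightarrow> Col a c b"
   "Col a b c \<Longrightarrow> Col c a b" "Col a b c \<Longrightarrow> Col c b a"
  unfolding Col_def using Bet_sym by blast+

lemma Col_trivial [simp]: "Col a a b" "Col a b a" "Col a b b" unfolding Col_def by auto

text \<open>
  The locus of points equidistant from \<open>p\<close> and \<open>q\<close> contains the line through any two of its points.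
\<close>

lemma equidistant_line:
  assumes "a \<noteq> b" "Col a b c" "len a p = len a q" "len b p = len b q"
  shows "len c p = len c q"
proof -
  consider "Bet a b c" | "Bet b c a" | "Bet c a b" using assms(2) Col_def by blast
  then show ?thesis
  proof cases
    case 1 then show ?thesis using five_seg[of a b c a b c p q] assms by simp
  next
    case 2 then show ?thesis using inner_five_seg[of b c a b c a p q] assms by simp
  next
    case 3 then show ?thesis using five_seg[of b a c b a c p q] assms Bet_sym by simp
  qed
qed

section \<open>Lines\<close>

definition line :: "'a \<Rightarrow> 'a \<Rightarrow> 'a set" where "line a b = {x. Col a b x}"

definition is_line :: "'a set \<Rightarrow> bool" where "is_line L \<longleftrightarrow> (\<exists>a b. a \<noteq> b \<and> L = line a b)"

lemma Col_trans:
  assumes "a \<noteq> b" "Col a b c" "Col a b d" shows "Col a c d"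
proof -
  consider "Bet a b c" "Bet a b d" | "Bet a b c" "Bet b d a" | "Bet a b c" "Bet d a b"
    | "Bet b c a" "Bet a b d" | "Bet b c a" "Bet b d a" | "Bet b c a" "Bet d a b"
    | "Bet c a b" "Bet a b d" | "Bet c a b" "Bet b d a" | "Bet c a b" "Bet d a b"
    using assms Col_def by blast
  then show ?thesis
  proof cases
    case 1 then show ?thesis using Bet_connected1[of a b c d] assms Col_def Bet_sym by blast
  next
    case 2 then show ?thesis using Bet_inner4 Col_def Bet_sym by blast
  next
    case 3 then show ?thesis using Bet_outer2 assms Col_def by blast
  next
    case 4 then show ?thesis using Bet_inner4 Col_def Bet_sym by blast
  next
    case 5 then show ?thesis using Bet_connected3[of a c b d] Col_def Bet_sym by blast
  next
    case 6 then show ?thesis using Bet_inner1 Col_def Bet_sym by blast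
  next
    case 7 then show ?thesis using Bet_outer2[of c a b d] assms Col_def Bet_sym by blast
  next
    case 8 then show ?thesis using Bet_inner1 Col_def Bet_sym by blast
  next
    case 9 then show ?thesis using Bet_connected2[of b a c d] assms Col_def Bet_sym by blast
  qed
qed

lemma line_sub: "a \<noteq> b \<Longrightarrow> c \<in> line a b \<Longrightarrow> d \<in> line a b \<Longrightarrow> c \<noteq> d \<Longrightarrow> line a b \<subseteq> line c d"
  unfolding line_def using Col_trans Col_perms by (smt (verit) mem_Collect_eq subsetI)

lemma line_eq:
  assumes "is_line L" "c \<in> L" "d \<in> L" "c \<noteq> d" shows "L = line c d"
proof -
  obtain a b where ab: "a \<noteq> b" "L = line a b" using assms is_line_def by blast
  have "a \<in> line a b" "b \<in> line a b" by (auto simp: line_def)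
  then have "a \<in> line c d" "b \<in> line c d" using line_sub[of a b c d] ab assms by auto
  then have "line c d \<subseteq> line a b" using line_sub[of c d a b] ab assms by auto
  then show ?thesis using line_sub[of a b c d] ab assms by auto
qed

lemma line_is_line: "a \<noteq> b \<Longrightarrow> is_line (line a b)" using is_line_def by blast
lemma in_line [simp]: "a \<in> line a b" "b \<in> line a b" by (auto simp: line_def)

lemma lines_eq:
  assumes "is_line L" "is_line M" "c \<noteq> d" "c \<in> L" "d \<in> L" "c \<in> M" "d \<in> M" shows "L = M"
  using line_eq assms by metis

lemma Bet_in_line:
  assumes "is_line L" "Bet a b c"
  shows "a \<in> L \<Longrightarrow> c \<in> L \<Longrightarrow> b \<in> L"
    "a \<in> L \<Longrightarrow> b \<in> L \<Longrightarrow> a \<noteq> b \<Longrightarrow> c \<in> L"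
    "b \<in> L \<Longrightarrow> c \<in> L \<Longrightarrow> b \<noteq> c \<Longrightarrow> a \<in> L"
proof -
  have c: "Col a b c" "Col a c b" "Col b c a" using assms(2) Col_def Bet_sym by blast+
  show "a \<in> L \<Longrightarrow> c \<in> L \<Longrightarrow> b \<in> L"
    using c line_eq[OF assms(1), of a c] Bet_identity assms(2) by (cases "a = c") (auto simp: line_def)
  show "a \<in> L \<Longrightarrow> b \<in> L \<Longrightarrow> a \<noteq> b \<Longrightarrow> c \<in> L"
    using c line_eq[OF assms(1), of a b] by (auto simp: line_def)
  show "b \<in> L \<Longrightarrow> c \<in> L \<Longrightarrow> b \<noteq> c \<Longrightarrow> a \<in> L"
    using c line_eq[OF assms(1), of b c] by (auto simp: line_def)
qed

lemma online_iff: "a \<noteq> b \<Longrightarrow> online x a b \<longleftrightarrow> x \<in> line a b"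
  unfolding online_def line_def Col_def Bet_def by auto

lemma collin_iff: "collin a b c \<longleftrightarrow> (\<exists>L. is_line L \<and> a \<in> L \<and> b \<in> L \<and> c \<in> L)"
  unfolding collin_def is_line_def using online_iff by blast

lemma collin_Col: "collin a b c \<longleftrightarrow> Col a b c"
proof
  assume "collin a b c"
  then obtain L where L: "is_line L" "a \<in> L" "b \<in> L" "c \<in> L" using collin_iff by blast
  show "Col a b c"
  proof (cases "a = b")
    case False
    then have "L = line a b" using line_eq L by blast
    then show ?thesis using L by (simp add: line_def)
  qed simp
next
  assume c: "Col a b c"
  show "collin a b c"
  proof (cases "a = b")
    case False then show ?thesis unfolding collin_iff using c line_is_line in_line by (metis line_def mem_Collect_eq)
  next
    case True
    obtain z where z: "z \<noteq> a" using other_point by blast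
    show ?thesis
    proof (cases "c = a")
      case t: True show ?thesis unfolding collin_iff t True[symmetric] using line_is_line[OF z] in_line by metis
    next
      case False then show ?thesis unfolding collin_iff True[symmetric] using line_is_line[OF False] in_line by metis
    qed
  qed
qed

lemma equidistant_Col: "p \<noteq> q \<Longrightarrow> len a p = len a q \<Longrightarrow> len b p = len b q \<Longrightarrow> len c p = len c q \<Longrightarrow> Col a b c"
  using upper_dim[of p q a b c] collin_Col C_iff by simp

text \<open>
  Inner Pasch without side conditions. In the degenerate cases the point is a vertex or one of the
  given points, chosen according to the order on the common line.
\<close>

lemma pasch:
  assumes "Bet a p c" "Bet b q c" shows "\<exists>x. Bet p x b \<and> Bet q x a"
proof -
  consider "a = p" | "p = c" | "b = q" | "q = c" | "Bt a p c" "Bt b q c"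
    using assms Bet_def by blast
  then show ?thesis
  proof cases
    case 5
    show ?thesis
    proof (cases "Col a b c")
      case False
      then show ?thesis using strict_pasch[of a b c p q] 5 collin_Col Bet_def by blast
    next
      case True
      then consider "Bet a b c" | "Bet b c a" | "Bet c a b" using Col_def by blast
      then show ?thesis
      proof cases
        case 1
        then have "Bet a b q" using Bet_inner1 assms by blast
        then show ?thesis using Bet_sym Bet_trivial by blast
      next
        case 2
        have "Bet p c b" using 2 assms Bet_sym Bet_inner3 by blast
        moreover have "Bet q c a" using 2 assms Bet_inner3 by blast
        ultimately show ?thesis by blast
      next
        case 3
        then have "Bet b a p" using assms Bet_sym Bet_inner1 by blast
        then show ?thesis using Bet_sym Bet_trivial by blast
      qed
    qed
  qed (use assms Bet_sym Bet_trivial in blast)+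
qed


section \<open>Midpoints and point reflections\<close>

definition mid :: "'a \<Rightarrow> 'a \<Rightarrow> 'a \<Rightarrow> bool" where
  "mid m a b \<longleftrightarrow> Bet a m b \<and> len m a = len m b"

lemma mid_sym: "mid m a b \<Longrightarrow> mid m b a" unfolding mid_def using Bet_sym by metis

lemma mid_exists_reflection: "\<exists>b. mid m a b"
  unfolding mid_def using segment_construction[of a m m a] by metis

lemma mid_reflection_unique: "mid m a b \<Longrightarrow> mid m a c \<Longrightarrow> b = c"
proof (cases "a = m")
  case True
  assume "mid m a b" "mid m a c"
  then show ?thesis using True len_nullD unfolding mid_def by metis
next
  case False
  assume "mid m a b" "mid m a c"
  then show ?thesis using construction_unique[OF False, of b c] unfolding mid_def by auto
qed

definition reflect :: "'a \<Rightarrow> 'a \<Rightarrow> 'a" where "reflect m a = (SOME b. mid m a b)"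

lemma mid_reflect: "mid m a (reflect m a)" unfolding reflect_def using mid_exists_reflection by (rule someI_ex)

lemma reflect_eq: "mid m a b \<Longrightarrow> reflect m a = b" using mid_reflection_unique mid_reflect by blast

lemma reflect_reflect [simp]: "reflect m (reflect m a) = a" using reflect_eq mid_reflect mid_sym by blast

lemma reflect_center [simp]: "reflect m m = m" by (rule reflect_eq) (simp add: mid_def)

lemma Bet_reflect: "Bet a m (reflect m a)" using mid_reflect mid_def by blast
lemma len_reflect: "len m (reflect m a) = len m a" using mid_reflect mid_def by metis
lemma reflect_fix: "reflect m a = a \<Longrightarrow> a = m" using Bet_reflect Bet_identity by metis

text \<open>
  Prolong \<open>pp'\<close> and \<open>qq'\<close> at both ends, each by the half length of the other, where the prime
  denotes the reflection. The four end points \<open>x, x'\<close> and \<open>y, y'\<close> are then equally far from \<open>m\<close>,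
  so vertical angles give \<open>xy = x'y'\<close>; the congruence descends from the end points to \<open>p\<close> and \<open>q\<close>
  by two inner five-segment configurations.
\<close>

lemma reflect_isometry: "len (reflect m p) (reflect m q) = len p q"
proof (cases "p = m \<or> q = m")
  case True
  then show ?thesis using len_reflect len_commute reflect_center by metis
next
  case False
  let ?p = "reflect m p" and ?q = "reflect m q"
  obtain x where x: "Bet ?p p x" "len p x = len m q" using segment_construction by blast
  obtain y where y: "Bet ?q q y" "len q y = len m p" using segment_construction by blast
  obtain x' where x': "Bet p ?p x'" "len ?p x' = len m q" using segment_construction by blast
  obtain y' where y': "Bet q ?q y'" "len ?q y' = len m p" using segment_construction by blast
  have ne: "m \<noteq> p" "m \<noteq> q" "?p \<noteq> m" "?q \<noteq> m" "p \<noteq> ?p" "q \<noteq> ?q" using False reflect_center reflect_reflect reflect_fix by metis+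
  have bp: "Bet m p x" "Bet m ?p x'" "Bet m q y" "Bet m ?q y'"
    using x x' y y' Bet_reflect Bet_sym Bet_inner3 by meson+
  have l: "len m x = len y m" "len m x' = len m x" "len m y' = len m y"
    using sum_segments[of m p x y q m] sum_segments[of m ?p x' m p x] sum_segments[of m ?q y' m q y]
      bp x x' y y' len_reflect Bet_sym len_commute by metis+
  have bx: "Bet x m x'"
  proof -
    have "Bet ?p m x" using x Bet_reflect Bet_sym Bet_inner4 by blast
    then have "Bet x m ?p" by (rule Bet_sym)
    then show ?thesis using bp(2) ne Bet_outer2 by metis
  qed
  have byy: "Bet y m y'"
  proof -
    have "Bet ?q m y" using y Bet_reflect Bet_sym Bet_inner4 by blast
    then have "Bet y m ?q" by (rule Bet_sym)
    then show ?thesis using bp(4) ne Bet_outer2 by metis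
  qed
  have xm: "x \<noteq> m" using bp(1) ne Bet_identity by metis
  have "len x' y' = len y x"
    using five_seg[OF xm bx Bet_sym[OF byy], of y' x] l len_commute by metis
  then have xy: "len x' y' = len x y" using len_commute by metis
  have "len q x = len ?q x'"
    using inner_five_seg[of y q m y' ?q m x x'] bp l xy Bet_sym len_reflect len_commute by metis
  then have "len p q = len ?p ?q"
    using inner_five_seg[of x p m x' ?p m q ?q] bp l Bet_sym len_reflect len_commute by metis
  then show ?thesis by simp
qed

lemma reflect_Bet: "Bet a b c \<Longrightarrow> Bet (reflect m a) (reflect m b) (reflect m c)"
  using Bet_transfer[of a b c "reflect m a" "reflect m b" "reflect m c"] reflect_isometry by simp

lemma reflect_mid: "mid n a b \<Longrightarrow> mid (reflect m n) (reflect m a) (reflect m b)"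
  unfolding mid_def using reflect_Bet reflect_isometry by simp

lemma reflect_line: "is_line L \<Longrightarrow> m \<in> L \<Longrightarrow> x \<in> L \<Longrightarrow> reflect m x \<in> L"
  using Bet_in_line(2)[of L x m "reflect m x"] Bet_reflect reflect_center by metis

lemma reflect_line_iff: "is_line L \<Longrightarrow> m \<in> L \<Longrightarrow> reflect m x \<in> L \<longleftrightarrow> x \<in> L"
  using reflect_line reflect_reflect by metis

text \<open>
  Prolong both legs equally beyond the base. Two uses of inner Pasch give the crossing point \<open>r\<close> of
  the diagonals \<open>aq\<close>, \<open>bp\<close> and then the point \<open>x\<close> where the line \<open>cr\<close> meets the base. The figure
  is symmetric, so \<open>r\<close> and with it \<open>x\<close> is equidistant from \<open>a\<close> and \<open>b\<close>.
\<close>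

lemma isosceles_midpoint: assumes "len c a = len c b" shows "\<exists>x. mid x a b"
proof (cases "Col a b c")
  case True
  show ?thesis
  proof (cases "a = b")
    case True then show ?thesis using mid_def[of a a a] by auto
  next
    case False
    consider "Bet a b c" | "Bet b c a" | "Bet c a b" using True Col_def by blast
    then show ?thesis
    proof cases
      case 1 then show ?thesis using Bet_same_len[of c b a] Bet_sym assms False by metis
    next
      case 2 then show ?thesis using mid_def[of c b a] mid_sym assms by metis
    next
      case 3 then show ?thesis using Bet_same_len[of c a b] assms False by metis
    qed
  qed
next
  case nc: False
  obtain p where p: "Bet c a p" "p \<noteq> a" using proper_extension by blast
  obtain q where q: "Bet c b q" "len b q = len a p" using segment_construction by blast
  have ne: "c \<noteq> a" "c \<noteq> b" "a \<noteq> b" using nc Col_trivial by blast+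
  obtain r where r: "Bet a r q" "Bet b r p" using pasch[of p a c q b] p q Bet_sym by blast
  obtain x where x: "Bet a x b" "Bet r x c" using pasch[of b r p c a] r p Bet_sym by metis
  have aq: "len a q = len b p"
    using five_seg[of c a p c b q b a] p q ne assms len_commute by metis
  \<comment> \<open>The mirror image \<open>r'\<close> of \<open>r\<close> lies on both diagonals, so it is \<open>r\<close>.\<close>
  obtain r' where r': "Bet a r' q" "len b r = len a r'" "len r p = len r' q"
    using transfer_between[of b r p a q] r(2) aq by metis
  have 1: "len r a = len r' b"
    using inner_five_seg[of b r p a r' q a b] r r' aq q len_commute by metis
  have 2: "len r q = len r' p"
    using inner_five_seg[of b r p a r' q q p] r r' aq q len_commute by metis
  have "Bet b r' p"
    using Bet_transfer[of a r q b r' p] r 1 2 aq len_commute by metis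
  moreover have "r = r'"
  proof (rule ccontr)
    assume nr: "r \<noteq> r'"
    have "a \<noteq> q"
    proof
      assume "a = q" then have "Col a b c" using q(1) Col_def Bet_sym by blast
      then show False using nc by simp
    qed
    have "b \<noteq> p"
    proof
      assume "b = p" then have "Col a b c" using p(1) Col_def Bet_sym by blast
      then show False using nc by simp
    qed
    have m: "r \<in> line a q" "r' \<in> line a q" "r \<in> line b p" "r' \<in> line b p"
      using Bet_in_line(1)[OF line_is_line[OF \<open>a \<noteq> q\<close>]] Bet_in_line(1)[OF line_is_line[OF \<open>b \<noteq> p\<close>]]
        r r' \<open>Bet b r' p\<close> by auto
    have "line a q = line b p"
      by (rule lines_eq[OF line_is_line line_is_line nr]) (use m \<open>a \<noteq> q\<close> \<open>b \<noteq> p\<close> in auto)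
    then have "a \<in> line b p" "b \<in> line b p" "p \<in> line b p" by (metis in_line)+
    then have "c \<in> line b p" using Bet_in_line(3)[OF line_is_line[OF \<open>b \<noteq> p\<close>] p(1)] p(2) by blast
    then show False using nc collin_Col collin_iff line_is_line[OF \<open>b \<noteq> p\<close>] \<open>a \<in> line b p\<close> in_line by blast
  qed
  ultimately have "len r a = len r b" using 1 by simp
  moreover have "r \<noteq> c"
  proof
    assume "r = c"
    then have "Bet a c q" "Bet b c p" using r by auto
    then have "Bet q c a" "Bet c b q" "Bet c a p" "Bet b c p" using p q Bet_sym by auto
    then have "Bet b c a" using Bet_sym Bet_inner1 p(1) by meson
    then show False using nc Col_def by blast
  qed
  ultimately have "len x a = len x b"
    using equidistant_line[of c r x a b] assms x(2) Col_def Bet_sym by metis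
  then show ?thesis using x(1) mid_def by blast
qed

text \<open>
  Circle-circle continuity gives an equilateral triangle over the segment.
\<close>

lemma mid_exists: "\<exists>m. mid m a b"
proof (cases "a = b")
  case True then show ?thesis using mid_def[of a a a] by auto
next
  case False
  have "\<exists>x. C a x a b \<and> C b x a b"
  proof (rule circle_circle[OF False])
    show "C a b a b" "C b b a a" "C a (reflect a b) a b" "C a b b a" using C_iff len_commute len_reflect len_null by metis+
    show "Bet a a b" by simp
    show "Bet b a (reflect a b)" by (rule Bet_reflect)
  qed
  then obtain c where "len a c = len b c" using C_iff by metis
  then show ?thesis using isosceles_midpoint[of c a b] len_commute by metis
qed

section \<open>Separation of the plane by a line\<close>

text \<open>
  The sides of a line, as far as a point reflection shows them: if \<open>L\<close> passes through
  the midpoint of \<open>ac\<close>, every point on a ray from \<open>L\<close> through \<open>a\<close> is separated from \<open>c\<close> by \<open>L\<close>. Points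
  between \<open>r\<close> and \<open>a\<close> need inner Pasch only. For points beyond \<open>a\<close>, the reflection in \<open>m\<close> moves the
  ray to one that passes through \<open>c\<close>, and inner Pasch applies with the reflected point as the apex.
\<close>

lemma ray_through_midpoint:
  assumes L: "is_line L" "m \<in> L" "r \<in> L" and m: "mid m a c" and out: "Bet r a b \<or> Bet r b a"
  shows "\<exists>x\<in>L. Bet b x c"
  using out
proof
  assume "Bet r b a"
  then obtain x where "Bet m x r" "Bet b x c" using pasch[of c m a r b] m mid_def Bet_sym by blast
  then show ?thesis using Bet_in_line(1)[OF L(1)] L by blast
next
  assume b: "Bet r a b"
  have "Bet (reflect m r) c (reflect m b)" using reflect_Bet[OF b, of m] reflect_eq[OF m] by simp
  then obtain x where x: "Bet m x (reflect m r)" "Bet c x b" using pasch[of b m "reflect m b" "reflect m r" c] Bet_reflect by blast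
  then show ?thesis using Bet_in_line(1)[OF L(1) x(1)] reflect_line[OF L] L Bet_sym by blast
qed

text \<open>
  Inner Pasch at the vertex \<open>c\<close> yields \<open>w\<close> on the cevians \<open>yb\<close> and \<open>xa\<close>, and at the vertex \<open>a\<close> a
  point \<open>u\<close> on \<open>wb\<close> and on \<open>zx\<close>. As \<open>u\<close> is on \<open>L\<close> and on the line \<open>yb\<close>, it is \<open>y\<close>. So \<open>y\<close> is both
  before and after \<open>w\<close> on the way to \<open>b\<close>, hence equal to \<open>w\<close> and on the cevian \<open>xa\<close>. Then \<open>L\<close> contains
  \<open>a\<close>, or else \<open>x = y\<close> and the triangle is degenerate.
\<close>

lemma line_avoids_triangle:
  assumes L: "is_line L" and out: "a \<notin> L" "b \<notin> L" "c \<notin> L" and on: "x \<in> L" "y \<in> L" "z \<in> L"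
    and bet: "Bet b x c" "Bet c y a" "Bet a z b"
  shows False
proof (cases "collin a b c")
  case True
  then obtain M where M: "is_line M" "a \<in> M" "b \<in> M" "c \<in> M" using collin_iff by blast
  then have "x \<in> M" "y \<in> M" "z \<in> M" using Bet_in_line(1)[OF M(1)] bet by blast+
  then have "x = y" "x = z" using lines_eq[OF L M(1)] on M out by blast+
  then have b: "Bet a x b" "Bet b x c" "Bet a x c" using bet Bet_sym by auto
  have "a \<noteq> x" "b \<noteq> x" "c \<noteq> x" using on out by auto
  then consider "Bet x b c" | "Bet x c b" using Bet_connected2[of a x b c] b by blast
  then show False
  proof cases
    case 1 then show False using Bet_antisym[of b x c] b \<open>b \<noteq> x\<close> by blast
  next
    case 2 then show False using Bet_antisym[of c x b] b \<open>c \<noteq> x\<close> Bet_sym by blast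
  qed
next
  case nc: False
  obtain w where w: "Bet y w b" "Bet x w a" using pasch[of a y c b x] bet Bet_sym by blast
  obtain u where u: "Bet z u x" "Bet w u b" using pasch[of b z a x w] bet w Bet_sym by blast
  have uL: "u \<in> L" using Bet_in_line(1)[OF L u(1)] on by blast
  have ne: "y \<noteq> b" "x \<noteq> b" "y \<noteq> c" "x \<noteq> c" "x \<noteq> a" "y \<noteq> a" using on out by auto
  have yb: "is_line (line y b)" using ne line_is_line by blast
  have "w \<in> line y b" using Bet_in_line(1)[OF yb w(1)] by simp
  then have "u \<in> line y b" using Bet_in_line(1)[OF yb u(2)] by simp
  then have "u = y" using lines_eq[OF L yb _ uL on(2)] out(2) in_line by metis
  then have "w = y" using u(2) w(1) Bet_antisym by blast
  then have "Bet x y a" using w by simp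
  then have "x = y" using Bet_in_line(2)[OF L] on out by blast
  let ?M = "line c x"
  have M: "is_line ?M" using ne line_is_line by metis
  have "b \<in> ?M" using Bet_in_line(3)[OF M bet(1)] ne by simp
  moreover have "a \<in> ?M" using Bet_in_line(2)[OF M bet(2)] ne \<open>x = y\<close> by simp
  ultimately show False using nc M collin_iff in_line by blast
qed

text \<open>
  For \<open>f\<close> on \<open>L\<close> this means that \<open>q\<close> is \<open>f\<close> or that the segment \<open>qf\<close> is perpendicular to \<open>L\<close>: an
  angle is right if one leg can be reflected in the vertex without changing distances to the other.
\<close>

definition perp :: "'a set \<Rightarrow> 'a \<Rightarrow> 'a \<Rightarrow> bool" where
  "perp L f q \<longleftrightarrow> (\<forall>x\<in>L. len x q = len x (reflect f q))"

text \<open>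
  In the isosceles triangle with apex \<open>a\<close> and base \<open>yc\<close> the angle at the midpoint \<open>p\<close> of the base is
  right. The triangle \<open>qzy\<close> is a copy of \<open>apy\<close> on the vertical angle at \<open>y\<close>; its right angle is at the
  point \<open>z\<close> of \<open>L\<close>, so the reflection \<open>q'\<close> of \<open>q\<close> in \<open>z\<close> is also the mirror image of \<open>q\<close> in \<open>L\<close>.
  Prolonging \<open>qy\<close> to \<open>c\<close> and \<open>q'y\<close> equally far to \<open>c'\<close> gives the mirror image of \<open>c\<close>, and the foot
  is the midpoint of \<open>cc'\<close>.
\<close>

lemma foot_exists:
  assumes L: "is_line L" and c: "c \<notin> L"
  shows "\<exists>f\<in>L. perp L f c"
proof -
  obtain a b where ab: "a \<noteq> b" "L = line a b" using L is_line_def by blast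
  then have inL: "a \<in> L" "b \<in> L" by auto
  then have ac: "a \<noteq> c" using c by auto
  obtain y where y: "Bet b a y" "len a y = len a c" using segment_construction by blast
  have yL: "y \<in> L" using Bet_in_line(2)[OF L y(1)] inL ab by blast
  have ya: "y \<noteq> a" using y ac len_nullD len_null by metis
  obtain p where p: "mid p y c" using mid_exists by blast
  have yc: "y \<noteq> c" using yL c by blast
  have yp: "y \<noteq> p" using p yc unfolding mid_def by (metis len_nullD)
  obtain z where z: "Bet a y z" "len y z = len y p" using segment_construction by blast
  have yz: "y \<noteq> z" using z yp len_nullD len_null by metis
  have zL: "z \<in> L" using Bet_in_line(2)[OF L z(1)] inL yL ya by blast
  obtain q where q: "Bet p y q" "len y q = len y a" using segment_construction by blast
  have yq: "y \<noteq> q" using q ya len_nullD len_null by metis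
  define q' where "q' = reflect z q"
  \<comment> \<open>Side-angle-side for the vertical angles at \<open>y\<close>.\<close>
  have zq: "len z q = len p a"
    using five_seg[of a y z q y p q a] z q ya Bet_sym len_commute by metis
  \<comment> \<open>The right angle at \<open>p\<close> is carried over to \<open>z\<close>.\<close>
  have "len c a = len (reflect z y) q"
    using five_seg[of y p c y z "reflect z y" a q] yp p z zq q Bet_reflect len_reflect len_commute
    unfolding mid_def by metis
  then have "len (reflect z y) q = len y q" using y q len_commute by metis
  then have yqq: "len y q' = len y q" using reflect_isometry[of z "reflect z y" q] unfolding q'_def by simp
  have zqq: "len z q' = len z q" unfolding q'_def by (rule len_reflect)
  obtain c' where c': "Bet q' y c'" "len y c' = len y c" using segment_construction by blast
  have qyc: "Bet q y c"
    using Bet_outer2[of q y p c] q p yp Bet_sym unfolding mid_def by blast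
  have zc: "len z c = len z c'"
    using five_seg[of q y c q' y c' z z] yq qyc c' yqq zqq len_commute by metis
  have cc: "c \<noteq> c'"
  proof
    assume "c = c'"
    then have "q = q'" using construction_unique[of c y q q'] c' qyc yc yqq Bet_sym by metis
    then have "q = z" using reflect_fix q'_def by metis
    then have "q \<in> L" using zL by simp
    then have "c \<in> L" using Bet_in_line(2)[OF L qyc] yL yq by blast
    then show False using c by simp
  qed
  have eq: "len x c = len x c'" if "x \<in> L" for x
  proof -
    have "Col y z x" using line_eq[OF L yL zL yz] that by (simp add: line_def)
    then show ?thesis using equidistant_line[OF yz _ _ zc] c' by metis
  qed
  obtain f where f: "mid f c c'" using mid_exists by blast
  have "Col y z f" using equidistant_Col[OF cc, of y z f] eq yL zL f mid_def by metis
  then have "f \<in> L" using line_eq[OF L yL zL yz] by (simp add: line_def)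
  moreover have "perp L f c" using eq reflect_eq[OF f] by (simp add: perp_def)
  ultimately show ?thesis by blast
qed

text \<open>
  The points \<open>q\<close>, \<open>r\<close> and \<open>f\<close> are all equidistant from two points of \<open>L\<close> that are symmetric about \<open>f\<close>,
  so the upper bound on the dimension makes them collinear.
\<close>

lemma perp_Col:
  assumes L: "is_line L" "f \<in> L" and p: "perp L f q" "perp L f r"
  shows "Col q f r"
proof -
  obtain u where u: "u \<in> L" "u \<noteq> f"
  proof -
    obtain a b where "a \<noteq> b" "L = line a b" using L is_line_def by blast
    then show thesis using that in_line by metis
  qed
  have *: "len s u = len s (reflect f u)" if "perp L f s" for s
  proof -
    have "len u s = len u (reflect f s)" using that u perp_def by blast
    then show ?thesis using reflect_isometry[of f "reflect f s" u] len_commute reflect_reflect by metis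
  qed
  show ?thesis
    using equidistant_Col[of u "reflect f u" q f r] *[OF p(1)] *[OF p(2)] reflect_fix u len_reflect by metis
qed

lemma perp_reflect:
  assumes L: "is_line L" "h \<in> L" and p: "perp L g r"
  shows "perp L (reflect h g) (reflect h r)"
proof -
  have e: "reflect (reflect h g) (reflect h r) = reflect h (reflect g r)" by (rule reflect_eq[OF reflect_mid[OF mid_reflect]])
  show ?thesis unfolding perp_def e
  proof
    fix x assume "x \<in> L"
    then have "reflect h x \<in> L" using reflect_line L by blast
    then have "len (reflect h x) r = len (reflect h x) (reflect g r)" using p perp_def by blast
    then show "len x (reflect h r) = len x (reflect h (reflect g r))" using reflect_isometry[of h "reflect h x"] reflect_reflect by metis
  qed
qed

text \<open>
  Let \<open>f\<close> be the foot of \<open>q\<close>. Reflecting \<open>r\<close> in the midpoint \<open>h\<close> of the two feet gives a point \<open>w\<close> that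
  is on the line \<open>qf\<close>, while the midpoint \<open>h\<close> of \<open>rw\<close> is on \<open>L\<close>. If \<open>w\<close> is on the
  ray from \<open>f\<close> through \<open>q\<close>, then \<open>L\<close> separates \<open>q\<close> from \<open>r\<close>. Likewise for \<open>r'\<close>, with a point \<open>w'\<close>. In the
  remaining case \<open>w\<close> and \<open>w'\<close> are on the same ray opposite to \<open>q\<close>; then \<open>L\<close> meets all three
  sides of the triangle \<open>r w' r'\<close>.
\<close>

lemma plane_pasch:
  assumes L: "is_line L" "p \<in> L" and m: "mid p r r'" and out: "r \<notin> L" "q \<notin> L"
  shows "(\<exists>x\<in>L. Bet q x r) \<or> (\<exists>x\<in>L. Bet q x r')"
proof (rule ccontr)
  assume none: "\<not> ?thesis"
  have r': "r' = reflect p r" "r' \<notin> L" using reflect_eq[OF m] reflect_line_iff[OF L] out by metis+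
  obtain f where f: "f \<in> L" "perp L f q" using foot_exists L out by blast
  have key: "\<exists>h\<in>L. reflect h s \<notin> L \<and> Bet q f (reflect h s)" if s: "s \<notin> L" "\<not> (\<exists>x\<in>L. Bet q x s)" for s
  proof -
    obtain g where g: "g \<in> L" "perp L g s" using foot_exists L s by blast
    obtain h where h: "mid h g f" using mid_exists by blast
    have hL: "h \<in> L" using h f g Bet_in_line(1)[OF L(1)] mid_def by blast
    have "perp L f (reflect h s)" using perp_reflect[OF L(1) hL g(2)] reflect_eq[OF h] by simp
    then have "Col q f (reflect h s)" using perp_Col L f by blast
    moreover have "\<not> (Bet f (reflect h s) q \<or> Bet f q (reflect h s))"
      using ray_through_midpoint[OF L(1) hL f(1), of "reflect h s" s q] s(2) mid_sym mid_reflect by blast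
    ultimately have "Bet q f (reflect h s)" using Col_def Bet_sym by blast
    then show ?thesis using hL reflect_line_iff L s by blast
  qed
  obtain h where h: "h \<in> L" "reflect h r \<notin> L" "Bet q f (reflect h r)" using key none out by blast
  obtain h' where h': "h' \<in> L" "reflect h' r' \<notin> L" "Bet q f (reflect h' r')" using key none r' by blast
  have "q \<noteq> f" using f out by blast
  then have "Bet f (reflect h r) (reflect h' r') \<or> Bet f (reflect h' r') (reflect h r)"
    using Bet_connected2[of q f "reflect h r" "reflect h' r'"] h h' by blast
  then obtain x where x: "x \<in> L" "Bet (reflect h' r') x r"
    using ray_through_midpoint[OF L(1) h(1) f(1), of "reflect h r" r "reflect h' r'"] mid_sym mid_reflect by blast
  show False
    using line_avoids_triangle[OF L(1) out(1) r'(2) h'(2) h'(1) x(1) L(2)] x(2) Bet_reflect m mid_def by blast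
qed

section \<open>From Euclid 5 to Playfair in a structure\<close>

definition euclid_5 :: bool where
  "euclid_5 \<longleftrightarrow> (\<forall>p q r s t a. Bt q a r \<and> Bt p t q \<and> Bt s t r \<and> C p t q t \<and> C r t s t \<and> p \<noteq> r \<and>
     \<not> online p s q \<longrightarrow> (\<exists>x. online x s q \<and> online x p a \<and> Bt p a x \<and> Bt s q x))"

lemma Bet_Bt: "Bet a b c \<Longrightarrow> a \<noteq> b \<Longrightarrow> b \<noteq> c \<Longrightarrow> Bt a b c" unfolding Bet_def by blast

text \<open>
  Euclid 5 for the parallelogram with centre \<open>t\<close>: the line \<open>N\<close> enters it at the vertex \<open>p\<close> and leaves it
  through the side from \<open>q\<close> to the reflection of \<open>s\<close>.
\<close>

lemma euclid_5_meets:
  assumes e5: euclid_5 and L: "is_line L" "q \<in> L" "s \<in> L" "q \<noteq> s" and p: "p \<notin> L" and t: "mid t p q"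
    and N: "is_line N" "p \<in> N" "reflect t s \<notin> N" "q \<notin> N" and x: "x \<in> N" "Bet q x (reflect t s)"
  shows "\<exists>y\<in>N. y \<in> L"
proof -
  have pq: "p \<noteq> q" using p L by blast
  have tp: "t \<noteq> p" "t \<noteq> q" using t pq unfolding mid_def by (metis len_nullD)+
  have tL: "t \<notin> L" using Bet_in_line(3)[OF L(1), of p t q] t tp L p mid_def by blast
  have "s \<noteq> t" using tL L by blast
  have sq: "line s q = L" using line_eq L by metis
  have "t \<noteq> reflect t s" using \<open>s \<noteq> t\<close> reflect_reflect reflect_center by metis
  then have b: "Bt q x (reflect t s)" "Bt p t q" "Bt s t (reflect t s)"
    using Bet_Bt[of q x "reflect t s"] Bet_Bt[of p t q] Bet_Bt[of s t "reflect t s"] x N t tp \<open>s \<noteq> t\<close> Bet_reflect[of s t] mid_def by blast+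
  have "len p t = len q t" using t len_commute unfolding mid_def by metis
  then have c1: "C p t q t" by (rule C_iff[THEN iffD2])
  have "len (reflect t s) t = len s t" using len_reflect len_commute by metis
  then have c2: "C (reflect t s) t s t" by (rule C_iff[THEN iffD2])
  have ne: "p \<noteq> reflect t s" using N by blast
  have "\<not> online p s q" using p L sq online_iff by metis
  then obtain y where y: "online y s q" "online y p x" "Bt p x y"
    using e5 b c1 c2 ne unfolding euclid_5_def by blast
  have "p \<noteq> x" using Bt_distinct y by blast
  then have "line p x = N" using line_eq N x by metis
  then have "y \<in> N" "y \<in> L" using y online_iff \<open>p \<noteq> x\<close> sq L by metis+
  then show ?thesis by blast
qed

text \<open>
  The point \<open>reflect q s\<close> takes the part of \<open>s\<close> on the other side of the line \<open>pq\<close>, so that \<open>N\<close> crosses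
  one of two parallelograms.
\<close>

lemma parallel_through:
  assumes e5: euclid_5 and L: "is_line L" "q \<in> L" "s \<in> L" "q \<noteq> s" and p: "p \<notin> L" and t: "mid t p q"
    and N: "is_line N" "p \<in> N" "N \<inter> L = {}"
  shows "reflect t s \<in> N"
proof (rule ccontr)
  assume r: "reflect t s \<notin> N"
  let ?s = "reflect q s"
  have s': "?s \<in> L" "q \<noteq> ?s" using reflect_line[OF L(1)] L reflect_center reflect_reflect by metis+
  \<comment> \<open>The reflection in \<open>t\<close> maps \<open>q\<close>, the midpoint of \<open>s\<close> and \<open>reflect q s\<close>, to the midpoint of their images.\<close>
  have "reflect t q = p" using reflect_eq t mid_sym by blast
  then have m: "mid p (reflect t s) (reflect t ?s)" using reflect_mid[OF mid_reflect, of t q s] by simp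
  have r': "reflect t ?s \<notin> N" using reflect_line_iff[OF N(1,2)] reflect_eq[OF m] r by metis
  have q: "q \<notin> N" using N L by blast
  from plane_pasch[OF N(1,2) m r q] show False
    using euclid_5_meets[OF e5 L p t N(1,2) r q] euclid_5_meets[OF e5 L(1,2) s' p t N(1,2) r' q] N(3) by blast
qed

theorem playfair_of_euclid_5:
  assumes e5: euclid_5 and L: "is_line L" "is_line K" "is_line M"
    and par: "K \<inter> L = {}" "M \<inter> L = {}" and p: "p \<in> K" "p \<in> M"
  shows "K = M"
proof -
  obtain q s where qs: "q \<noteq> s" "L = line q s" using L is_line_def by blast
  obtain t where t: "mid t p q" using mid_exists by blast
  have inL: "q \<in> L" "s \<in> L" "p \<notin> L" using qs par p by auto
  have "reflect t s \<in> K" "reflect t s \<in> M" using parallel_through[OF e5 L(1) inL(1,2) qs(1) inL(3) t] L par p by blast+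
  moreover have "p \<noteq> reflect t s" using reflect_eq[OF t] qs(1) reflect_reflect by metis
  ultimately show ?thesis using lines_eq L p by blast
qed

end


section \<open>The structure given by a truth set\<close>

lemmas sentence_defs = sentence_def pAll_def pEx_def pAnd_def pOr_def pImp_def pNot_def pIff_def
  pEq_def B_def congr_def T_def on_line_def collinear_def seg_le_def parallel_def on_circle_def
  inside_def outside_def

text \<open>
  A truth set against Playfair's axiom gives a structure whose points are the parameters modulo the
  equations in the set. A type cannot depend on a set that is fixed inside a proof, so one such set
  is chosen here for the whole development. That there is none is the point of the final proof.
\<close>

definition counter_set :: "fm set" where
  "counter_set = (SOME S. truth_set S \<and> neutral_geometry \<subseteq> S \<and> sentence euclid5 \<in> S \<and>
     sentence playfair \<notin> S)"

typedef point = "range (\<lambda>x. {y. Eq (Par x) (Par y) \<in> counter_set})" by blast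

definition pt :: "nat \<Rightarrow> point" where
  "pt x = Abs_point {y. Eq (Par x) (Par y) \<in> counter_set}"

definition pt_B :: "point \<Rightarrow> point \<Rightarrow> point \<Rightarrow> bool" where
  "pt_B a b c \<longleftrightarrow> (\<exists>x y z. a = pt x \<and> b = pt y \<and> c = pt z \<and>
     Betw (Par x) (Par y) (Par z) \<in> counter_set)"

definition pt_C :: "point \<Rightarrow> point \<Rightarrow> point \<Rightarrow> point \<Rightarrow> bool" where
  "pt_C a b c d \<longleftrightarrow> (\<exists>x y z w. a = pt x \<and> b = pt y \<and> c = pt z \<and> d = pt w \<and>
     Congr (Par x) (Par y) (Par z) (Par w) \<in> counter_set)"

abbreviation "pt_T \<equiv> betw_cong.Bet pt_B"
abbreviation "pt_online \<equiv> betw_cong.online pt_B"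
abbreviation "pt_collin \<equiv> betw_cong.collin pt_B"

lemmas pt_geometry_defs = betw_cong.Bet_def betw_cong.online_def betw_cong.collin_def

lemma pt_surj: "\<exists>x. a = pt x"
  unfolding pt_def by (cases a rule: Abs_point_cases) blast

lemma all_pt: "(\<forall>a. P a) \<longleftrightarrow> (\<forall>x. P (pt x))"
proof -
  have "P a" if "\<forall>x. P (pt x)" for a using that pt_surj[of a] by auto
  then show ?thesis by blast
qed

lemma ex_pt: "(\<exists>a. P a) \<longleftrightarrow> (\<exists>x. P (pt x))"
  using all_pt[of "\<lambda>a. \<not> P a"] by blast

context
  assumes S: "truth_set counter_set"
begin

lemma in_counter_set:
  "Falsum \<notin> counter_set"
  "Conj p q \<in> counter_set \<longleftrightarrow> p \<in> counter_set \<and> q \<in> counter_set"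
  "Disj p q \<in> counter_set \<longleftrightarrow> p \<in> counter_set \<or> q \<in> counter_set"
  "Imp p q \<in> counter_set \<longleftrightarrow> (p \<in> counter_set \<longrightarrow> q \<in> counter_set)"
  "Forall p \<in> counter_set \<longleftrightarrow> (\<forall>x. inst 0 x p \<in> counter_set)"
  "Exists p \<in> counter_set \<longleftrightarrow> (\<exists>x. inst 0 x p \<in> counter_set)"
  by (rule truth_set.Falsum truth_set.Conj truth_set.Disj truth_set.Imp truth_set.Forall
      truth_set.Exists, rule S)+

lemmas Eq_subst = truth_set.Eq_subst[OF S]
lemmas Eq_refl = truth_set.Eq_refl[OF S]

lemma Eq_sym: "Eq (Par x) (Par y) \<in> counter_set \<Longrightarrow> Eq (Par y) (Par x) \<in> counter_set"
  using Eq_subst[of x y "Eq (Bnd 0) (Par x)"] Eq_refl by simp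

lemma Eq_trans:
  "Eq (Par x) (Par y) \<in> counter_set \<Longrightarrow> Eq (Par y) (Par z) \<in> counter_set \<Longrightarrow>
   Eq (Par x) (Par z) \<in> counter_set"
  using Eq_subst[of y z "Eq (Par x) (Bnd 0)"] by simp

lemma Eq_iff: "Eq (Par x) (Par y) \<in> counter_set \<longleftrightarrow> pt x = pt y"
proof -
  have "pt x = pt y \<longleftrightarrow>
      {z. Eq (Par x) (Par z) \<in> counter_set} = {z. Eq (Par y) (Par z) \<in> counter_set}"
    unfolding pt_def by (rule Abs_point_inject; rule rangeI)
  then show ?thesis using Eq_refl Eq_sym Eq_trans by blast
qed

lemma Betw_iff: "Betw (Par x) (Par y) (Par z) \<in> counter_set \<longleftrightarrow> pt_B (pt x) (pt y) (pt z)"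
proof
  assume "pt_B (pt x) (pt y) (pt z)"
  then obtain a b c where e: "Eq (Par a) (Par x) \<in> counter_set" "Eq (Par b) (Par y) \<in> counter_set"
    "Eq (Par c) (Par z) \<in> counter_set" and m: "Betw (Par a) (Par b) (Par c) \<in> counter_set"
    unfolding pt_B_def Eq_iff by metis
  show "Betw (Par x) (Par y) (Par z) \<in> counter_set"
    using Eq_subst[OF e(1), of "Betw (Bnd 0) (Par b) (Par c)"]
      Eq_subst[OF e(2), of "Betw (Par x) (Bnd 0) (Par c)"]
      Eq_subst[OF e(3), of "Betw (Par x) (Par y) (Bnd 0)"] m by simp
qed (auto simp: pt_B_def)

lemma Congr_iff:
  "Congr (Par x) (Par y) (Par z) (Par w) \<in> counter_set \<longleftrightarrow> pt_C (pt x) (pt y) (pt z) (pt w)"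
proof
  assume "pt_C (pt x) (pt y) (pt z) (pt w)"
  then obtain a b c d where e: "Eq (Par a) (Par x) \<in> counter_set" "Eq (Par b) (Par y) \<in> counter_set"
    "Eq (Par c) (Par z) \<in> counter_set" "Eq (Par d) (Par w) \<in> counter_set"
    and m: "Congr (Par a) (Par b) (Par c) (Par d) \<in> counter_set"
    unfolding pt_C_def Eq_iff by metis
  show "Congr (Par x) (Par y) (Par z) (Par w) \<in> counter_set"
    using Eq_subst[OF e(1), of "Congr (Bnd 0) (Par b) (Par c) (Par d)"]
      Eq_subst[OF e(2), of "Congr (Par x) (Bnd 0) (Par c) (Par d)"]
      Eq_subst[OF e(3), of "Congr (Par x) (Par y) (Bnd 0) (Par d)"]
      Eq_subst[OF e(4), of "Congr (Par x) (Par y) (Par z) (Bnd 0)"] m by simp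
qed (auto simp: pt_C_def)

lemmas to_points = in_counter_set Eq_iff Betw_iff Congr_iff

text \<open>
  Membership of an axiom in the truth set, computed by the simplifier, is literally the axiom read
  in the structure of points, up to the normal form in which the simplifier leaves it.
\<close>

lemma neutral_plane_points:
  assumes N: "neutral_geometry \<subseteq> counter_set" and two: "\<exists>a b :: point. a \<noteq> b"
  shows "neutral_plane pt_B pt_C"
proof -
  have ax: "\<forall>p\<in>congruence_axioms. sentence p \<in> counter_set"
    "\<forall>p\<in>betweenness_axioms. sentence p \<in> counter_set"
    "\<forall>p\<in>dimension_axioms. sentence p \<in> counter_set"
    "sentence extension_axiom \<in> counter_set" "sentence five_segment_axiom \<in> counter_set"
    "sentence inner_pasch_axiom \<in> counter_set" "sentence circle_circle_axiom \<in> counter_set"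
    using N unfolding neutral_geometry_def by blast+
  note [simp] = to_points
  note congruence = ax(1)[unfolded congruence_axioms_def sentence_defs, simplified]
  note betweenness = ax(2)[unfolded betweenness_axioms_def sentence_defs, simplified]
  note dimension = ax(3)[unfolded dimension_axioms_def sentence_defs, simplified]
  note extension = ax(4)[unfolded extension_axiom_def sentence_defs, simplified]
  note five_segment = ax(5)[unfolded five_segment_axiom_def sentence_defs, simplified]
  note inner_pasch = ax(6)[unfolded inner_pasch_axiom_def sentence_defs, simplified]
  note circle_circle = ax(7)[unfolded circle_circle_axiom_def sentence_defs, simplified]
  have congruence': "\<forall>a b. pt_C a b b a"
    "\<forall>a b p q r s. pt_C a b p q \<and> pt_C a b r s \<longrightarrow> pt_C p q r s"
    "\<forall>a b c. pt_C a b c c \<longrightarrow> a = b"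
    unfolding all_pt ex_pt using congruence by blast+
  have betweenness': "\<forall>a b c. pt_B a b c \<longrightarrow> pt_B c b a \<and> a \<noteq> b \<and> b \<noteq> c" "\<forall>a b. \<not> pt_B a b a"
    "\<forall>a b c d. pt_T a b d \<and> pt_T b c d \<longrightarrow> pt_T a b c \<and> pt_T a c d"
    "\<forall>a b c d. pt_T a b c \<and> pt_T b c d \<and> b \<noteq> c \<longrightarrow> pt_T a c d \<and> pt_T a b d"
    unfolding all_pt pt_geometry_defs using betweenness by - (elim conjE, assumption)+
  have connected': "\<forall>a b c d. pt_B a b c \<and> pt_B a b d \<longrightarrow> pt_T a c d \<or> pt_T a d c"
    unfolding all_pt pt_geometry_defs
    using betweenness[THEN conjunct2, THEN conjunct2, THEN conjunct2, THEN conjunct2] by blast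
  have dimension': "\<forall>p q a b c. p \<noteq> q \<and> pt_C a p a q \<and> pt_C b p b q \<and> pt_C c p c q \<longrightarrow>
      pt_collin a b c"
    unfolding all_pt ex_pt pt_geometry_defs using dimension[THEN conjunct2] by simp
  have extension': "\<forall>a b c d. \<exists>x. a \<noteq> b \<longrightarrow> pt_T a b x \<and> pt_C b x c d"
    unfolding all_pt ex_pt pt_geometry_defs using extension by blast
  have five_segment': "\<forall>a b c d a' b' c' d'.
      a \<noteq> b \<and> pt_T a b c \<and> pt_T a' b' c' \<and> pt_C a b a' b' \<and> pt_C b c b' c' \<and>
      pt_C a d a' d' \<and> pt_C b d b' d' \<longrightarrow> pt_C c d c' d'"
    unfolding all_pt ex_pt pt_geometry_defs using five_segment by blast
  have inner_pasch': "\<forall>a b c p q. \<exists>x. \<not> pt_collin a b c \<and> pt_B a p c \<and> pt_B b q c \<longrightarrow>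
      pt_B p x b \<and> pt_B q x a"
    unfolding all_pt ex_pt pt_geometry_defs using inner_pasch by blast
  have circle_circle': "\<forall>c r s c' r' s'. c \<noteq> c' \<and>
      (\<exists>p. pt_C c p r s \<and> (\<exists>e. pt_T r' e s' \<and> pt_C c' p r' e) \<and>
        (\<exists>q. pt_C c q r s \<and> (\<exists>e. pt_T c' e q \<and> pt_C r' s' c' e))) \<longrightarrow>
      (\<exists>x. pt_C c x r s \<and> pt_C c' x r' s')"
    unfolding all_pt ex_pt pt_geometry_defs by (rule circle_circle)
  show ?thesis
    by (unfold_locales, use congruence' in blast, use congruence' in blast,
        use congruence' in blast, use extension' in blast, use five_segment' in blast,
        use betweenness'(1) in blast, use betweenness'(1) in blast, use betweenness'(2) in blast,
        use betweenness'(3) in blast, use betweenness'(4) in blast, use connected' in blast,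
        use inner_pasch' in blast, rule two, use dimension' in blast, use circle_circle' in blast)
qed

lemma euclid_5_points:
  assumes "neutral_plane pt_B pt_C" "sentence euclid5 \<in> counter_set"
  shows "neutral_plane.euclid_5 pt_B pt_C"
proof -
  note [simp] = to_points
  note e = assms(2)[unfolded euclid5_def sentence_defs, simplified]
  show ?thesis
    unfolding neutral_plane.euclid_5_def[OF assms(1)] pt_geometry_defs all_pt ex_pt
    using e by blast
qed

lemma playfair_points:
  assumes N: "neutral_geometry \<subseteq> counter_set" and e: "sentence euclid5 \<in> counter_set"
  shows "sentence playfair \<in> counter_set"
proof -
  note [simp] = to_points
  have "pt_online x k k' \<longleftrightarrow> pt_online x m m'"
    if ne: "k \<noteq> k'" "m \<noteq> m'" "l \<noteq> l'"
      and par: "\<not> (\<exists>x. pt_online x k k' \<and> pt_online x l l')"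
        "\<not> (\<exists>x. pt_online x m m' \<and> pt_online x l l')"
      and p: "pt_online p k k'" "pt_online p m m'" for k k' m m' l l' p x
  proof -
    interpret neutral_plane pt_B pt_C using neutral_plane_points N ne by blast
    have "line k k' = line m m'"
      by (rule playfair_of_euclid_5[of "line l l'",
            OF _ line_is_line line_is_line line_is_line])
        (use ne par p e euclid_5_points neutral_plane_axioms online_iff in auto)
    then show ?thesis using online_iff ne by blast
  qed
  \<comment> \<open>The quantifiers stand where the simplifier moves them, so that this is its normal form.\<close>
  then have *: "\<forall>k k' m m'. k \<noteq> k' \<and> m \<noteq> m' \<and> (\<exists>l l'. l \<noteq> l' \<and>
      \<not> (\<exists>x. pt_online x k k' \<and> pt_online x l l') \<and>
      \<not> (\<exists>x. pt_online x m m' \<and> pt_online x l l') \<and>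
      (\<exists>p. pt_online p k k' \<and> pt_online p m m')) \<longrightarrow>
      (\<forall>x. (pt_online x k k' \<longrightarrow> pt_online x m m') \<and> (pt_online x m m' \<longrightarrow> pt_online x k k'))"
    by blast
  show ?thesis
    unfolding playfair_def sentence_defs
    by (simp (no_asm) del: imp_disjL de_Morgan_conj de_Morgan_disj not_ex)
      (rule *[unfolded pt_geometry_defs all_pt ex_pt])
qed

end


section \<open>The implication in intuitionistic logic\<close>

lemma axioms_transfer_into:
  "p \<in> insert (sentence euclid5) neutral_geometry \<Longrightarrow> transfers Into p"
  unfolding neutral_geometry_def stability_axioms_def congruence_axioms_def betweenness_axioms_def
    dimension_axioms_def extension_axiom_def five_segment_axiom_def inner_pasch_axiom_def
    line_circle_axiom_def circle_circle_axiom_def euclid5_def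
  by (auto simp: sentence_defs)

theorem theorem6p11: "neutral_geometry \<turnstile> sentence (euclid5 \<^bold>\<longrightarrow> playfair)"
proof -
  let ?G = "insert (sentence euclid5) neutral_geometry"
  have "?G \<turnstile> sentence playfair"
  proof (rule classical_semantics_suffices)
    show "finite ?G"
      unfolding neutral_geometry_def stability_axioms_def congruence_axioms_def
        betweenness_axioms_def dimension_axioms_def by simp
    \<comment> \<open>Atoms occur in the conclusion of Playfair's axiom only under negations.\<close>
    show "transfers Out (sentence playfair)" by (simp add: playfair_def sentence_defs)
    fix S assume S: "truth_set S" "?G \<subseteq> S"
    show "sentence playfair \<in> S"
    proof (rule ccontr)
      assume "sentence playfair \<notin> S"
      then have "\<exists>S. truth_set S \<and> neutral_geometry \<subseteq> S \<and> sentence euclid5 \<in> S \<and>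
          sentence playfair \<notin> S" using S by blast
      then have "truth_set counter_set \<and> neutral_geometry \<subseteq> counter_set \<and>
          sentence euclid5 \<in> counter_set \<and> sentence playfair \<notin> counter_set"
        unfolding counter_set_def by (rule someI_ex)
      then show False using playfair_points by blast
    qed
  qed (rule axioms_transfer_into)
  then show ?thesis by (auto simp: sentence_def pImp_def intro: ImpI)
qed

end
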